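(* Let $\varepsilon>0$, $d = \mathcal{O}(\log n/\varepsilon^2)$ large enough, $m \le n$ with $d$ dividing both $m$ and $n$, $s = m/d$ a power of two, $k = \log_2 s$, and $t = \frac{n-m}{d}+1$. Given input $x\in\mathbb{R}^n$, let $y_1,\ldots,y_t\in\mathbb{R}^m$ be $y_i = (x_{1+(i-1)d},\ldots,x_{m+(i-1)d})$. For $\varepsilon \le \frac{1}{k}$, the procedure AllSketch (described below) outputs $v_1,\ldots,v_t\in\mathbb{R}^d$ such that $\|v_j\| = (1\pm\mathcal{O}(k\varepsilon))\|y_j\|$ with high probability, in time $\mathcal{O}\!\left(\frac{n\log^2 n}{\varepsilon}\right)$. Moreover, the map $y_i \mapsto v_i$ is linear and identical to the map $y_i \mapsto$ SingleSketch$(y_i)$ computed with the same maps $\varphi_1,\ldots,\varphi_k$.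
   Context: $\|\cdot\|$ is the Euclidean norm. A random map $\varphi:\mathbb{R}^d\times\mathbb{R}^d\to\mathbb{R}^d$ is drawn from the distribution $\mathcal{F}$: $\varphi(x,y)=A_0x+A_1y$ where $A_0,A_1$ are $d\times d$ matrices with entries in $\{-\frac{1}{\sqrt r},0,\frac1{\sqrt r}\}$, each column having exactly $r=\mathcal{O}(d\varepsilon)$ nonzero entries (sparse Johnson–Lindenstrauss matrices with random nonzero positions and uniformly random signs), so $\varphi$ is evaluated in $\mathcal{O}(d^2\varepsilon)$ time, and for any fixed $x,y\in\mathbb{R}^d$, $\Pr_{\varphi\sim\mathcal F}(\|\varphi(x,y)\|^2=(1\pm\varepsilon)(\|x\|^2+\|y\|^2)) = 1-n^{-\Omega(1)}$. Let $\varphi_1,\ldots,\varphi_k$ be fully independent maps drawn from $\mathcal{F}$. Procedure SingleSketch$(z)$ for $z\in\mathbb{R}^m$: partition $z$ into $s$ consecutive blocks $w^{(0)}_1,\ldots,w^{(0)}_s\in\mathbb{R}^d$; for $i=1,\ldots,k$, $j=1,\ldots,2^{k-i}$, set $w^{(i)}_j=\varphi_i(w^{(i-1)}_{2j-1},w^{(i-1)}_{2j})$; return $w^{(k)}_1$. Procedure AllSketch$(x)$: partition $x=(x_1,\ldots,x_n)$ into $n/d$ vectors $v^{(0)}_i = (x_{d(i-1)+1},\ldots,x_{di})$; for $i=1,\ldots,k$ and $j = 1,\ldots,\frac{n}{d}-2^i+1$ set $v^{(i)}_j = \varphi_i(v^{(i-1)}_j, v^{(i-1)}_{j+2^{i-1}})$;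 return $v^{(k)}_1,\ldots,v^{(k)}_t$. "With high probability" means with probability at least $1-n^{-\Omega(1)}$. *)

theory Defs
  imports
    "HOL-Probability.Probability"
    "HOL-Probability.Product_PMF"
    "HOL-Library.Monad_Syntax"
    "Jordan_Normal_Form.Matrix"
begin

no_notation Finite_Cartesian_Product.vec_nth (infixl \<open>$\<close> 90)
no_notation Inner_Product.real_inner_class.inner (infix \<open>\<bullet>\<close> 70)


text \<open>\<^bold>\<open>Sparse Johnson--Lindenstrauss maps.\<close>
  Vectors and matrices are those of Jordan Normal Form (dimension carried by the value).
  The uniform distribution on \<open>sjl_matrices d r\<close> is the one in which the columns are
  independent, the support of each column is a uniformly random \<open>r\<close>-subset of the rows, and the
  signs are independent and uniform.\<close>

definition sjl_matrices :: "nat \<Rightarrow> nat \<Rightarrow> real mat set" where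
  "sjl_matrices d r = {A \<in> carrier_mat d d.
     (\<forall>i<d. \<forall>j<d. A $$ (i, j) \<in> {- (1 / sqrt r), 0, 1 / sqrt r}) \<and>
     (\<forall>j<d. card {i. i < d \<and> A $$ (i, j) \<noteq> 0} = r)}"

definition sjl_dist :: "nat \<Rightarrow> nat \<Rightarrow> (real mat \<times> real mat) pmf" where
  "sjl_dist d r = pair_pmf (pmf_of_set (sjl_matrices d r)) (pmf_of_set (sjl_matrices d r))"

definition sketch_maps :: "nat \<Rightarrow> nat \<Rightarrow> nat \<Rightarrow> (nat \<Rightarrow> real mat \<times> real mat) pmf" where
  "sketch_maps k d r = Pi_pmf {1..k} undefined (\<lambda>_. sjl_dist d r)"

definition app_map :: "real mat \<times> real mat \<Rightarrow> real vec \<Rightarrow> real vec \<Rightarrow> real vec" where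
  "app_map A x y = fst A *\<^sub>v x + snd A *\<^sub>v y"

definition vnorm :: "real vec \<Rightarrow> real" where
  "vnorm v = sqrt (v \<bullet> v)"

definition vec_linear :: "nat \<Rightarrow> nat \<Rightarrow> (real vec \<Rightarrow> real vec) \<Rightarrow> bool" where
  "vec_linear m d f \<longleftrightarrow>
     (\<forall>u \<in> carrier_vec m. f u \<in> carrier_vec d) \<and>
     (\<forall>u \<in> carrier_vec m. \<forall>v \<in> carrier_vec m. f (u + v) = f u + f v) \<and>
     (\<forall>a. \<forall>u \<in> carrier_vec m. f (a \<cdot>\<^sub>v u) = a \<cdot>\<^sub>v f u)"


text \<open>\<^bold>\<open>The sketches.\<close>
  Blocks, windows, levels and maps are numbered from 1; the coordinates of a vector are numbered
  from 0. \<open>single_sketch_level d \<phi> z i j\<close> is $w^{(i)}_j$ and \<open>all_sketch_level d \<phi> x i j\<close> is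
  $v^{(i)}_j$; only indices \<open>j\<close> in the ranges of the two procedures are meaningful.\<close>

definition block :: "nat \<Rightarrow> real vec \<Rightarrow> nat \<Rightarrow> real vec" where
  "block d z j = vec d (\<lambda>l. z $ (d * (j - 1) + l))"

definition window :: "nat \<Rightarrow> nat \<Rightarrow> real vec \<Rightarrow> nat \<Rightarrow> real vec" where
  "window m d x j = vec m (\<lambda>l. x $ ((j - 1) * d + l))"

primrec single_sketch_level ::
    "nat \<Rightarrow> (nat \<Rightarrow> real mat \<times> real mat) \<Rightarrow> real vec \<Rightarrow> nat \<Rightarrow> nat \<Rightarrow> real vec" where
  "single_sketch_level d \<phi> z 0 = (\<lambda>j. block d z j)"
| "single_sketch_level d \<phi> z (Suc i) = (\<lambda>j.
     app_map (\<phi> (Suc i)) (single_sketch_level d \<phi> z i (2 * j - 1))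
                          (single_sketch_level d \<phi> z i (2 * j)))"

definition single_sketch ::
    "nat \<Rightarrow> nat \<Rightarrow> (nat \<Rightarrow> real mat \<times> real mat) \<Rightarrow> real vec \<Rightarrow> real vec" where
  "single_sketch k d \<phi> z = single_sketch_level d \<phi> z k 1"

primrec all_sketch_level ::
    "nat \<Rightarrow> (nat \<Rightarrow> real mat \<times> real mat) \<Rightarrow> real vec \<Rightarrow> nat \<Rightarrow> nat \<Rightarrow> real vec" where
  "all_sketch_level d \<phi> x 0 = (\<lambda>j. block d x j)"
| "all_sketch_level d \<phi> x (Suc i) = (\<lambda>j.
     app_map (\<phi> (Suc i)) (all_sketch_level d \<phi> x i j)
                          (all_sketch_level d \<phi> x i (j + 2 ^ i)))"

definition all_sketch ::
    "nat \<Rightarrow> nat \<Rightarrow> (nat \<Rightarrow> real mat \<times> real mat) \<Rightarrow> real vec \<Rightarrow> nat \<Rightarrow> real vec" where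
  "all_sketch k d \<phi> x j = all_sketch_level d \<phi> x k j"


text \<open>\<^bold>\<open>Running time.\<close>
  The procedure is written as a program on a random access machine with real and index registers,
  as a computation that returns its result together with the number of steps. Every arithmetic
  operation on reals or indices, every read or write of an array cell, and every loop iteration
  (including access to the current list element) is one step. Arrays are threaded linearly, so updates are in place.\<close>

datatype 'a tm = TM (val: 'a) (time: nat)

definition return_tm :: "'a \<Rightarrow> 'a tm" where
  "return_tm a = TM a 0"

definition bind_tm :: "'a tm \<Rightarrow> ('a \<Rightarrow> 'b tm) \<Rightarrow> 'b tm" where
  "bind_tm p f = TM (val (f (val p))) (time p + time (f (val p)))"

adhoc_overloading Monad_Syntax.bind \<rightleftharpoons> bind_tm

definition add_tm :: "'a::plus \<Rightarrow> 'a \<Rightarrow> 'a tm" where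
  "add_tm a b = TM (a + b) 1"

definition sub_tm :: "'a::minus \<Rightarrow> 'a \<Rightarrow> 'a tm" where
  "sub_tm a b = TM (a - b) 1"

definition mul_tm :: "'a::times \<Rightarrow> 'a \<Rightarrow> 'a tm" where
  "mul_tm a b = TM (a * b) 1"

definition new_tm :: "nat \<Rightarrow> real vec tm" where
  "new_tm l = TM (0\<^sub>v l) l"

definition read_tm :: "real vec \<Rightarrow> nat \<Rightarrow> real tm" where
  "read_tm v p = TM (v $ p) 1"

definition write_tm :: "real vec \<Rightarrow> nat \<Rightarrow> real \<Rightarrow> real vec tm" where
  "write_tm v p a = TM (vec (dim_vec v) (\<lambda>l. if l = p then a else v $ l)) 1"

primrec loop_tm :: "'b list \<Rightarrow> ('b \<Rightarrow> 's \<Rightarrow> 's tm) \<Rightarrow> 's \<Rightarrow> 's tm" where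
  "loop_tm [] body st = return_tm st"
| "loop_tm (b # bs) body st =
     do { _ \<leftarrow> TM () 1; st' \<leftarrow> body b st; loop_tm bs body st' }"

text \<open>The maps are part of the input and are stored sparsely, as lists of the triples
  (row, column, value) of their nonzero entries.\<close>

definition sparse_entries :: "real mat \<Rightarrow> (nat \<times> nat \<times> real) list" where
  "sparse_entries A =
     [(i, c, A $$ (i, c)). c \<leftarrow> [0..<dim_col A], i \<leftarrow> [0..<dim_row A], A $$ (i, c) \<noteq> 0]"

text \<open>Adds to the segment of \<open>out\<close> starting at \<open>dst\<close> the product of the stored matrix with the
  segment of \<open>inp\<close> starting at \<open>src\<close>.\<close>

definition mult_add_tm ::
    "(nat \<times> nat \<times> real) list \<Rightarrow> real vec \<Rightarrow> nat \<Rightarrow> nat \<Rightarrow> real vec \<Rightarrow> real vec tm" where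
  "mult_add_tm E inp src dst out =
     loop_tm E (\<lambda>(i, c, a) out. do {
       p \<leftarrow> add_tm src c;
       u \<leftarrow> read_tm inp p;
       q \<leftarrow> add_tm dst i;
       w \<leftarrow> read_tm out q;
       y \<leftarrow> mul_tm a u;
       z \<leftarrow> add_tm w y;
       write_tm out q z
     }) out"

text \<open>All vectors $v^{(i)}_1, v^{(i)}_2, \dots$ of a level are kept consecutively in one array, so
  the input array \<open>x\<close> itself is level 0. The state of the outer loop consists of the array of the
  current level, its number of vectors, and the shift $2^{i-1}$. The input
  consists of the number \<open>N\<close> of blocks, their length \<open>d\<close>, the list \<open>Es\<close> of the stored maps
  $\varphi_1, \dots, \varphi_k$, and \<open>x\<close>.\<close>

definition all_sketch_tm ::
    "nat \<Rightarrow> nat \<Rightarrow>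
     ((nat \<times> nat \<times> real) list \<times> (nat \<times> nat \<times> real) list) list \<Rightarrow> real vec \<Rightarrow>
     (real vec \<times> nat \<times> nat) tm" where
  "all_sketch_tm N d Es x =
     loop_tm Es (\<lambda>(E\<^sub>0, E\<^sub>1) (cur, cnt, h). do {
       cnt' \<leftarrow> sub_tm cnt h;
       len \<leftarrow> mul_tm cnt' d;
       nxt \<leftarrow> new_tm len;
       nxt \<leftarrow> loop_tm [0..<cnt'] (\<lambda>j nxt. do {
         p \<leftarrow> mul_tm d j;
         j' \<leftarrow> add_tm j h;
         p' \<leftarrow> mul_tm d j';
         nxt \<leftarrow> mult_add_tm E\<^sub>0 cur p p nxt;
         mult_add_tm E\<^sub>1 cur p' p nxt
       }) nxt;
       h' \<leftarrow> mul_tm 2 h;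
       return_tm (nxt, cnt', h')
     }) (x, N, 1)"

definition all_sketch_prog ::
    "nat \<Rightarrow> nat \<Rightarrow> nat \<Rightarrow> (nat \<Rightarrow> real mat \<times> real mat) \<Rightarrow> real vec \<Rightarrow> real vec tm" where
  "all_sketch_prog n k d \<phi> x =
     do { (out, _, _) \<leftarrow> all_sketch_tm (n div d) d
            (map (\<lambda>i. map_prod sparse_entries sparse_entries (\<phi> i)) [1..<k+1]) x;
          return_tm out }"

end

theory Submission
  imports Defs
begin

text \<open>
  For a fixed input, the matrix of \<open>\<phi>\<close> applied to a unit vector \<open>u\<close> distorts the squared norm by
  \<open>Z = \<Sum>\<^sub>l (G\<^sub>l\<^sup>2 - V\<^sub>l)\<close>, where, conditionally on the supports of the columns, the \<open>G\<^sub>l\<close> are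
  independent Rademacher sums (one per row \<open>l\<close>) with variances \<open>V\<^sub>l \<le> 1/r\<close>. Averaging over the
  signs one at a time with \<open>cosh a \<le> exp (a\<^sup>2/2)\<close> bounds \<open>E exp (\<nu> Z)\<close>, for \<open>\<bar>\<nu>\<bar> \<le> r/4\<close>, by
  \<open>E exp (4 (\<nu>/r)\<^sup>2 \<Sum>\<^sub>i\<^sub>\<noteq>\<^sub>j u\<^sub>i\<^sup>2 u\<^sub>j\<^sup>2 |S\<^sub>i \<inter> S\<^sub>j|)\<close>, where \<open>S\<^sub>i\<close> is the support of column \<open>i\<close>.
  Jensen's inequality reduces this to a single pair of columns, and the moment generating function
  of the hypergeometric variable \<open>|S\<^sub>i \<inter> S\<^sub>j|\<close> gives \<open>E exp (\<nu> Z) \<le> exp (8 \<nu>\<^sup>2/d)\<close>. A Chernoff bound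
  with \<open>\<nu> = 2L/\<epsilon>\<close> and \<open>L = (c + 3) ln n\<close> shows that a map distorts a fixed pair of vectors by more
  than \<open>1 \<plusminus> \<epsilon>\<close> with probability at most \<open>2 n\<^sup>-\<^sup>(\<^sup>c\<^sup>+\<^sup>3\<^sup>)\<close>. Since \<open>\<phi>\<^sub>i\<close> is independent of the inputs of
  level \<open>i\<close>, a union bound over the at most \<open>n\<^sup>2\<close> vectors of AllSketch bounds all distortions, which
  compound over the \<open>k\<close> levels to \<open>(1 \<plusminus> \<epsilon>)\<^sup>k = 1 \<plusminus> O(k\<epsilon>)\<close>.
\<close>

section \<open>Rademacher chaos\<close>

text \<open>Hoeffding's lemma for a fair variable on 0 and \<open>2 * y\<close>, recentred by the
  factor \<open>exp (- y)\<close>; evenness of cosh covers negative arguments.\<close>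

lemma cosh_le_exp_square_half:
  fixes x :: real
  shows "cosh x \<le> exp (x\<^sup>2 / 2)"
proof -
  have *: "cosh y \<le> exp (y\<^sup>2 / 2)" if "y \<ge> 0" for y :: real
  proof -
    have pos: "1 + 1 / 2 * (exp (2 * y) - 1) > 0"
      by (simp add: algebra_simps add_pos_pos)
    have "- (2 * y) * (1 / 2) + ln (1 + 1 / 2 * (exp (2 * y) - 1)) \<le> (2 * y)\<^sup>2 / 8"
      using that by (intro Hoeffdings_lemma_aux) auto
    then have "ln (1 + 1 / 2 * (exp (2 * y) - 1)) \<le> y + y\<^sup>2 / 2"
      by (simp add: power2_eq_square)
    then have "1 + 1 / 2 * (exp (2 * y) - 1) \<le> exp (y + y\<^sup>2 / 2)"
      using pos by (metis exp_le_cancel_iff exp_ln)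
    then have "exp (- y) * (1 + 1 / 2 * (exp (2 * y) - 1)) \<le> exp (- y) * exp (y + y\<^sup>2 / 2)"
      by (intro mult_left_mono) auto
    moreover have "exp (- y) * (1 + 1 / 2 * (exp (2 * y) - 1)) = cosh y"
      by (simp add: cosh_field_def algebra_simps flip: exp_add)
    ultimately show ?thesis
      by (simp flip: exp_add)
  qed
  show ?thesis
    using *[of "\<bar>x\<bar>"] by simp
qed

text \<open>The distributions averaged over below have finite support, so Fubini is a rearrangement
  of finite sums with no condition on \<open>f\<close>.\<close>

lemma expectation_pair_pmf_finite:
  fixes f :: "'a \<times> 'b \<Rightarrow> real"
  assumes "finite (set_pmf p)" "finite (set_pmf q)"
  shows "measure_pmf.expectation (pair_pmf p q) f =
    measure_pmf.expectation p (\<lambda>x. measure_pmf.expectation q (\<lambda>y. f (x, y)))"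
proof -
  have "measure_pmf.expectation (pair_pmf p q) f =
      (\<Sum>z\<in>set_pmf p \<times> set_pmf q. f z * pmf (pair_pmf p q) z)"
    using assms by (intro integral_measure_pmf_real) auto
  also have "\<dots> = (\<Sum>x\<in>set_pmf p. (\<Sum>y\<in>set_pmf q. f (x, y) * pmf q y) * pmf p x)"
    by (simp add: sum.cartesian_product' pmf_pair sum_distrib_left mult_ac)
  also have "\<dots> = measure_pmf.expectation p (\<lambda>x. measure_pmf.expectation q (\<lambda>y. f (x, y)))"
    using assms by (simp add: integral_measure_pmf_real[of "set_pmf p"]
        integral_measure_pmf_real[of "set_pmf q"])
  finally show ?thesis .
qed

lemma expectation_mono_pmf_finite:
  fixes f g :: "'a \<Rightarrow> real"
  assumes "finite (set_pmf p)" "\<And>x. x \<in> set_pmf p \<Longrightarrow> f x \<le> g x"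
  shows "measure_pmf.expectation p f \<le> measure_pmf.expectation p g"
  using assms by (intro integral_mono_AE integrable_measure_pmf_finite AE_pmfI)

lemma finite_set_Pi_pmf:
  assumes "finite A" "\<And>x. x \<in> A \<Longrightarrow> finite (set_pmf (p x))"
  shows "finite (set_pmf (Pi_pmf A dflt p))"
  using assms by (simp add: set_Pi_pmf finite_PiE_dflt)

definition rademacher :: "real pmf" where
  "rademacher = pmf_of_set {- 1, 1}"

lemma set_rademacher [simp]: "set_pmf rademacher = {- 1, 1}"
  by (simp add: rademacher_def)

text \<open>Used with squares for \<open>f\<close>: the squared sum of squares minus the sum of
  fourth powers is nonnegative, so a coefficient in front of this gap may be enlarged.\<close>

lemma sum_power2_le_power2_sum:
  fixes f :: "'a \<Rightarrow> real"
  assumes "finite A" "\<And>x. x \<in> A \<Longrightarrow> f x \<ge> 0"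
  shows "(\<Sum>x\<in>A. (f x)\<^sup>2) \<le> (\<Sum>x\<in>A. f x)\<^sup>2"
  using assms
proof (induction A rule: finite_induct)
  case (insert x A)
  then have "0 \<le> f x * sum f A"
    by (intro mult_nonneg_nonneg sum_nonneg) auto
  with insert show ?case
    by (simp add: power2_sum)
qed simp

text \<open>The terms with equal indices are constant and drop out of the exponent, which is why the
  bound involves \<open>(\<Sum>b\<^sub>j\<^sup>2)\<^sup>2 - \<Sum>b\<^sub>j\<^sup>4\<close> and not just \<open>(\<Sum>b\<^sub>j\<^sup>2)\<^sup>2\<close>. Averaging over the sign of index \<open>i\<close>
  replaces \<open>\<mu>\<close> by \<open>\<mu> + 2\<mu>\<^sup>2b\<^sub>i\<^sup>2\<close>, which decreases \<open>1/\<bar>\<mu>\<bar>\<close> by at most \<open>2b\<^sub>i\<^sup>2\<close>.\<close>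

lemma rademacher_chaos_mgf:
  fixes b :: "'a \<Rightarrow> real"
  assumes "finite J" "2 * \<bar>\<mu>\<bar> * (\<Sum>j\<in>J. (b j)\<^sup>2) < 1"
  shows "measure_pmf.expectation (Pi_pmf J 0 (\<lambda>_. rademacher))
      (\<lambda>s. exp (\<mu> * ((\<Sum>j\<in>J. s j * b j)\<^sup>2 - (\<Sum>j\<in>J. (b j)\<^sup>2))))
    \<le> exp ((\<mu> / (1 - 2 * \<bar>\<mu>\<bar> * (\<Sum>j\<in>J. (b j)\<^sup>2)))\<^sup>2
        * ((\<Sum>j\<in>J. (b j)\<^sup>2)\<^sup>2 - (\<Sum>j\<in>J. (b j) ^ 4)))"
  using assms
proof (induction J arbitrary: \<mu> rule: finite_induct)
  case empty
  then show ?case by simp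
next
  case (insert i J)
  define V where "V = (\<Sum>j\<in>J. (b j)\<^sup>2)"
  define W where "W = (\<Sum>j\<in>J. (b j) ^ 4)"
  define \<mu>' where "\<mu>' = \<mu> + 2 * \<mu>\<^sup>2 * (b i)\<^sup>2"
  define R where "R = Pi_pmf J 0 (\<lambda>_. rademacher)"
  define G where "G = (\<lambda>s::'a \<Rightarrow> real. \<Sum>j\<in>J. s j * b j)"
  have finR: "finite (set_pmf R)"
    unfolding R_def using insert.hyps by (intro finite_set_Pi_pmf) auto
  have V0: "V \<ge> 0"
    unfolding V_def by (intro sum_nonneg) auto
  have VW: "W \<le> V\<^sup>2"
  proof -
    have "W = (\<Sum>j\<in>J. ((b j)\<^sup>2)\<^sup>2)" by (simp add: W_def)
    also have "\<dots> \<le> V\<^sup>2"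
      unfolding V_def using insert.hyps by (intro sum_power2_le_power2_sum) auto
    finally show ?thesis .
  qed
  have sumV: "(\<Sum>j\<in>insert i J. (b j)\<^sup>2) = V + (b i)\<^sup>2"
    using insert.hyps by (simp add: V_def)
  have sumW: "(\<Sum>j\<in>insert i J. (b j) ^ 4) = W + (b i) ^ 4"
    using insert.hyps by (simp add: W_def)
  have lt: "2 * \<bar>\<mu>\<bar> * V + 2 * \<bar>\<mu>\<bar> * (b i)\<^sup>2 < 1"
    using insert.prems by (simp add: sumV algebra_simps)
  define a where "a = 2 * \<bar>\<mu>\<bar> * (b i)\<^sup>2"
  define v where "v = 2 * \<bar>\<mu>\<bar> * V"
  have a0: "a \<ge> 0" and v0: "v \<ge> 0" and av: "v + a < 1"
    using V0 lt by (auto simp: a_def v_def)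
  have absm: "\<bar>\<mu>'\<bar> \<le> \<bar>\<mu>\<bar> * (1 + a)"
  proof -
    have "\<bar>\<mu>'\<bar> \<le> \<bar>\<mu>\<bar> + \<bar>2 * \<mu>\<^sup>2 * (b i)\<^sup>2\<bar>"
      unfolding \<mu>'_def by (rule abs_triangle_ineq)
    also have "\<dots> = \<bar>\<mu>\<bar> * (1 + a)"
      by (simp add: a_def abs_mult power2_eq_square algebra_simps)
    finally show ?thesis .
  qed
  \<comment> \<open>The two sides differ by \<open>a\<^sup>2\<close>. Together with
    \<open>absm\<close> this lets the factor \<open>1 + a\<close> in the bound on \<mu>' cancel
    against the denominator.\<close>
  have step: "(1 + a) * (1 - v - a) \<le> 1 - v * (1 + a)"
    using a0 by (simp add: algebra_simps)
  have mV: "2 * \<bar>\<mu>'\<bar> * V \<le> v * (1 + a)"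
    using mult_right_mono[OF absm V0] by (simp add: v_def algebra_simps)
  have pos1: "(1 + a) * (1 - v - a) > 0"
    using a0 av by simp
  have lt': "2 * \<bar>\<mu>'\<bar> * V < 1"
    using mV step pos1 by linarith
  have coef: "(\<mu>' / (1 - 2 * \<bar>\<mu>'\<bar> * V))\<^sup>2 \<le> (\<mu> / (1 - v - a))\<^sup>2"
  proof -
    have "\<bar>\<mu>'\<bar> / (1 - 2 * \<bar>\<mu>'\<bar> * V) \<le> (\<bar>\<mu>\<bar> * (1 + a)) / ((1 + a) * (1 - v - a))"
      using absm mV step pos1 lt' by (intro frac_le) auto
    also have "\<dots> = \<bar>\<mu>\<bar> / (1 - v - a)"
      using a0 by simp
    finally have "\<bar>\<mu>' / (1 - 2 * \<bar>\<mu>'\<bar> * V)\<bar> \<le> \<bar>\<mu> / (1 - v - a)\<bar>"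
      using lt' av by simp
    then show ?thesis
      by (rule abs_le_square_iff[THEN iffD1])
  qed
  have coef2: "\<mu>\<^sup>2 \<le> (\<mu> / (1 - v - a))\<^sup>2"
  proof -
    have "\<bar>\<mu>\<bar> * (1 - v - a) \<le> \<bar>\<mu>\<bar> * 1"
      using a0 v0 by (intro mult_left_mono) auto
    then have "\<bar>\<mu>\<bar> \<le> \<bar>\<mu>\<bar> / (1 - v - a)"
      using av by (simp add: pos_le_divide_eq)
    then have "\<bar>\<mu>\<bar> \<le> \<bar>\<mu> / (1 - v - a)\<bar>"
      using av by simp
    then show ?thesis by (rule abs_le_square_iff[THEN iffD1])
  qed
  have "measure_pmf.expectation (Pi_pmf (insert i J) 0 (\<lambda>_. rademacher))
      (\<lambda>s. exp (\<mu> * ((\<Sum>j\<in>insert i J. s j * b j)\<^sup>2 - (\<Sum>j\<in>insert i J. (b j)\<^sup>2))))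
    = measure_pmf.expectation (pair_pmf R rademacher)
      (\<lambda>(s, y). exp (\<mu> * ((y * b i + G s)\<^sup>2 - (V + (b i)\<^sup>2))))"
  proof -
    have "(\<Sum>j\<in>J. (s(i := y)) j * b j) = G s" for s y
      unfolding G_def using insert.hyps by (intro sum.cong) auto
    then show ?thesis
      using insert.hyps unfolding sumV
      by (subst Pi_pmf_insert, simp, simp, subst pair_commute_pmf)
        (simp add: case_prod_beta R_def)
  qed
  also have "\<dots> = measure_pmf.expectation R
      (\<lambda>s. measure_pmf.expectation rademacher (\<lambda>y. exp (\<mu> * ((y * b i + G s)\<^sup>2 - (V + (b i)\<^sup>2)))))"
    using finR by (subst expectation_pair_pmf_finite) auto
  \<comment> \<open>As \<open>y\<^sup>2 = 1\<close>, only the cross term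
    \<open>2 * y * b i * G s\<close> depends on the sign, and averaging it gives a cosh.\<close>
  also have "\<dots> = measure_pmf.expectation R
      (\<lambda>s. exp (\<mu> * ((G s)\<^sup>2 - V)) * cosh (2 * \<mu> * b i * G s))"
    by (simp add: rademacher_def integral_pmf_of_set cosh_field_def power2_eq_square algebra_simps
        flip: exp_add)
  also have "\<dots> \<le> measure_pmf.expectation R
      (\<lambda>s. exp (2 * \<mu>\<^sup>2 * (b i)\<^sup>2 * V) * exp (\<mu>' * ((G s)\<^sup>2 - V)))"
  proof (rule expectation_mono_pmf_finite[OF finR])
    fix s
    have "exp (\<mu> * ((G s)\<^sup>2 - V)) * cosh (2 * \<mu> * b i * G s)
        \<le> exp (\<mu> * ((G s)\<^sup>2 - V)) * exp ((2 * \<mu> * b i * G s)\<^sup>2 / 2)"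
      by (intro mult_left_mono cosh_le_exp_square_half) auto
    also have "\<dots> = exp (2 * \<mu>\<^sup>2 * (b i)\<^sup>2 * V) * exp (\<mu>' * ((G s)\<^sup>2 - V))"
      by (simp add: \<mu>'_def power2_eq_square algebra_simps flip: exp_add)
    finally show "exp (\<mu> * ((G s)\<^sup>2 - V)) * cosh (2 * \<mu> * b i * G s)
      \<le> exp (2 * \<mu>\<^sup>2 * (b i)\<^sup>2 * V) * exp (\<mu>' * ((G s)\<^sup>2 - V))" .
  qed
  also have "\<dots> = exp (2 * \<mu>\<^sup>2 * (b i)\<^sup>2 * V)
      * measure_pmf.expectation R (\<lambda>s. exp (\<mu>' * ((G s)\<^sup>2 - V)))"
    by simp
  also have "\<dots> \<le> exp (2 * \<mu>\<^sup>2 * (b i)\<^sup>2 * V)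
      * exp ((\<mu>' / (1 - 2 * \<bar>\<mu>'\<bar> * V))\<^sup>2 * (V\<^sup>2 - W))"
    using insert.IH[of \<mu>'] lt' by (simp add: R_def G_def V_def W_def)
  \<comment> \<open>The constant factor left by the cosh bound pays for the cross term
    \<open>2 * (b i)\<^sup>2 * V\<close> that the target exponent has beyond the induction
    hypothesis.\<close>
  also have "\<dots> \<le> exp ((\<mu> / (1 - v - a))\<^sup>2 * (2 * (b i)\<^sup>2 * V))
      * exp ((\<mu> / (1 - v - a))\<^sup>2 * (V\<^sup>2 - W))"
  proof (rule mult_mono)
    have "\<mu>\<^sup>2 * (2 * (b i)\<^sup>2 * V) \<le> (\<mu> / (1 - v - a))\<^sup>2 * (2 * (b i)\<^sup>2 * V)"
      using V0 by (intro mult_right_mono[OF coef2]) auto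
    then show "exp (2 * \<mu>\<^sup>2 * (b i)\<^sup>2 * V) \<le> exp ((\<mu> / (1 - v - a))\<^sup>2 * (2 * (b i)\<^sup>2 * V))"
      by (simp add: algebra_simps)
    show "exp ((\<mu>' / (1 - 2 * \<bar>\<mu>'\<bar> * V))\<^sup>2 * (V\<^sup>2 - W))
      \<le> exp ((\<mu> / (1 - v - a))\<^sup>2 * (V\<^sup>2 - W))"
      using VW by (simp add: mult_right_mono[OF coef])
  qed auto
  also have "\<dots> = exp ((\<mu> / (1 - v - a))\<^sup>2 * ((V + (b i)\<^sup>2)\<^sup>2 - (W + (b i) ^ 4)))"
  proof -
    have "(V + (b i)\<^sup>2)\<^sup>2 - (W + (b i) ^ 4) = 2 * (b i)\<^sup>2 * V + (V\<^sup>2 - W)"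
      by (simp add: power2_eq_square power4_eq_xxxx algebra_simps)
    then show ?thesis by (simp only: distrib_left exp_add)
  qed
  also have "1 - v - a = 1 - 2 * \<bar>\<mu>\<bar> * (V + (b i)\<^sup>2)"
    by (simp add: v_def a_def algebra_simps)
  finally show ?case
    unfolding sumV sumW .
qed

section \<open>Random sparse columns\<close>

text \<open>Functions on all of nat that vanish from \<open>d\<close> on, rather than vectors, so
  that families of columns fit \<open>Pi_pmf\<close> with default zero.\<close>

definition sjl_columns :: "nat \<Rightarrow> nat \<Rightarrow> (nat \<Rightarrow> real) set" where
  "sjl_columns d r = {v. (\<forall>l. v l \<in> {- (1 / sqrt r), 0, 1 / sqrt r}) \<and> (\<forall>l\<ge>d. v l = 0) \<and>
     card {l. v l \<noteq> 0} = r}"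

lemma finite_sjl_columns: "finite (sjl_columns d r)"
proof (rule finite_subset)
  show "sjl_columns d r \<subseteq> PiE_dflt {..<d} 0 (\<lambda>_. {- (1 / sqrt r), 0, 1 / sqrt r})"
    by (auto simp: sjl_columns_def PiE_dflt_def)
qed (auto intro!: finite_PiE_dflt)

lemma sjl_columns_nonempty:
  assumes "0 < r" "r \<le> d"
  shows "sjl_columns d r \<noteq> {}"
proof -
  have "{l. (if l < r then 1 / sqrt r else 0) \<noteq> 0} = {..<r}"
    using assms by auto
  then have "(\<lambda>l. if l < r then 1 / sqrt r else 0) \<in> sjl_columns d r"
    using assms by (auto simp: sjl_columns_def)
  then show ?thesis by blast
qed

lemma sjl_columns_support:
  assumes "v \<in> sjl_columns d r"
  shows "{l. v l \<noteq> 0} \<subseteq> {..<d}" "finite {l. v l \<noteq> 0}" "card {l. v l \<noteq> 0} = r"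
proof -
  show *: "{l. v l \<noteq> 0} \<subseteq> {..<d}"
    using assms by (force simp: sjl_columns_def not_le[symmetric])
  show "finite {l. v l \<noteq> 0}"
    using * finite_subset by blast
qed (use assms in \<open>auto simp: sjl_columns_def\<close>)

lemma sjl_columns_power2:
  assumes "v \<in> sjl_columns d r"
  shows "(v l)\<^sup>2 = (if v l \<noteq> 0 then 1 / r else 0)"
proof -
  have "v l \<in> {- (1 / sqrt r), 0, 1 / sqrt r}"
    using assms by (simp add: sjl_columns_def)
  then show ?thesis by (auto simp: power_divide)
qed

lemma sjl_columns_norm:
  assumes "v \<in> sjl_columns d r" "0 < r"
  shows "(\<Sum>l<d. (v l)\<^sup>2) = 1"
proof -
  have "{..<d} \<inter> {l. v l \<noteq> 0} = {l. v l \<noteq> 0}"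
    using sjl_columns_support(1)[OF assms(1)] by blast
  then show ?thesis
    using sjl_columns_support[OF assms(1)] assms(2)
    by (simp add: sjl_columns_power2[OF assms(1)] sum.If_cases)
qed

text \<open>Exchangeability of the rows; it replaces any explicit formula for the number of
  columns.\<close>

lemma sjl_columns_transpose:
  assumes "v \<in> sjl_columns d r" "a < d" "b < d"
  shows "v \<circ> Transposition.transpose a b \<in> sjl_columns d r"
proof -
  have "{l. v (Transposition.transpose a b l) \<noteq> 0} = Transposition.transpose a b ` {l. v l \<noteq> 0}"
    by (force simp: image_iff intro: exI[of _ "Transposition.transpose a b _"])
  moreover have "card (Transposition.transpose a b ` {l. v l \<noteq> 0}) = card {l. v l \<noteq> 0}"
    by (intro card_image inj_on_subset[OF inj_transpose]) auto
  ultimately show ?thesis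
    using assms by (auto simp: sjl_columns_def Transposition.transpose_def)
qed

text \<open>By exchangeability all rows outside \<open>U\<close> are equally likely to be further
  support rows, so consecutive counts have ratio at most \<open>(r - card U) / (d - card U)\<close>,
  which is at most \<open>r / d\<close>. Hence \<open>U\<close> lies in a random support with
  probability at most \<open>(r / d) ^ card U\<close>, as if rows were chosen independently.\<close>

lemma card_sjl_columns_superset:
  assumes "U \<subseteq> {..<d}" "r \<le> d"
  shows "real d ^ card U * card {v \<in> sjl_columns d r. \<forall>l\<in>U. v l \<noteq> 0}
    \<le> real r ^ card U * card (sjl_columns d r)"
proof -
  define N where "N U = {v \<in> sjl_columns d r. \<forall>l\<in>U. v l \<noteq> 0}" for U
  have finN: "finite (N U)" for U
    unfolding N_def using finite_sjl_columns by simp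
  have sym: "card (N (insert a U)) \<le> card (N (insert b U))"
    if "a < d" "b < d" "a \<notin> U" "b \<notin> U" for a b U
  proof (rule card_inj_on_le)
    show "inj_on (\<lambda>v. v \<circ> Transposition.transpose a b) (N (insert a U))"
      by (intro inj_onI) (metis comp_assoc comp_id transpose_comp_involutory)
    show "(\<lambda>v. v \<circ> Transposition.transpose a b) ` N (insert a U) \<subseteq> N (insert b U)"
    proof safe
      fix v assume v: "v \<in> N (insert a U)"
      then have "v \<circ> Transposition.transpose a b \<in> sjl_columns d r"
        using that by (auto simp: N_def intro: sjl_columns_transpose)
      then show "v \<circ> Transposition.transpose a b \<in> N (insert b U)"
        using v that by (auto simp: N_def Transposition.transpose_def)
    qed
  qed (rule finN)
  have step: "real d * card (N (insert a U)) \<le> real r * card (N U)"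
    if "a < d" "a \<notin> U" "U \<subseteq> {..<d}" for a U
  proof -
    have finU: "finite U" using that finite_subset by blast
    have cU: "card U < d"
      using that psubset_card_mono[of "{..<d}" U] by (auto simp: psubset_eq)
    have "(d - card U) * card (N (insert a U)) = (\<Sum>b\<in>{..<d} - U. card (N (insert a U)))"
      using that finU by (simp add: card_Diff_subset)
    also have "\<dots> \<le> (\<Sum>b\<in>{..<d} - U. card (N (insert b U)))"
      using that by (intro sum_mono sym) auto
    also have "\<dots> = (\<Sum>b\<in>{..<d} - U. \<Sum>v\<in>N U. if v b \<noteq> 0 then 1 else 0)"
    proof (intro sum.cong refl)
      fix b assume "b \<in> {..<d} - U"
      have "N (insert b U) = N U \<inter> {v. v b \<noteq> 0}" by (auto simp: N_def)
      then show "card (N (insert b U)) = (\<Sum>v\<in>N U. if v b \<noteq> 0 then 1 else 0)"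
        using finN[of U] by (simp add: sum.If_cases)
    qed
    \<comment> \<open>Double counting: a column whose support contains \<open>U\<close> has exactly
      \<open>r - card U\<close> further support rows.\<close>
    also have "\<dots> = (\<Sum>v\<in>N U. card (({..<d} - U) \<inter> {b. v b \<noteq> 0}))"
      by (subst sum.swap) (simp add: sum.If_cases)
    also have "\<dots> = (\<Sum>v\<in>N U. r - card U)"
    proof (intro sum.cong refl)
      fix v assume "v \<in> N U"
      then have v: "v \<in> sjl_columns d r" "U \<subseteq> {l. v l \<noteq> 0}" by (auto simp: N_def)
      have "({..<d} - U) \<inter> {b. v b \<noteq> 0} = {b. v b \<noteq> 0} - U"
        using sjl_columns_support(1)[OF v(1)] by auto
      then show "card (({..<d} - U) \<inter> {b. v b \<noteq> 0}) = r - card U"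
        using v(2) sjl_columns_support(3)[OF v(1)] finU by (simp add: card_Diff_subset)
    qed
    finally have *: "(d - card U) * card (N (insert a U)) \<le> (r - card U) * card (N U)"
      by (simp add: mult.commute)
    have frac: "d * (r - card U) \<le> r * (d - card U)"
      using assms(2) by (simp add: diff_mult_distrib2 mult.commute diff_le_mono2)
    have "(d - card U) * (d * card (N (insert a U))) \<le> d * ((r - card U) * card (N U))"
      using mult_le_mono2[OF *, of d] by (simp only: mult_ac)
    also have "\<dots> \<le> (d - card U) * (r * card (N U))"
      using mult_le_mono1[OF frac, of "card (N U)"] by (simp only: mult_ac)
    finally have "d * card (N (insert a U)) \<le> r * card (N U)"
      using cU by simp
    then show ?thesis
      by (simp flip: of_nat_mult)
  qed
  have "finite U" using assms(1) finite_subset by blast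
  then have "real d ^ card U * card (N U) \<le> real r ^ card U * card (N {})"
    using assms(1)
  proof (induction U rule: finite_induct)
    case (insert a U)
    have "real d ^ card (insert a U) * card (N (insert a U))
        = real d ^ card U * (real d * card (N (insert a U)))"
      using insert.hyps by simp
    also have "\<dots> \<le> real d ^ card U * (real r * card (N U))"
      using insert by (intro mult_left_mono step) auto
    also have "\<dots> = real r * (real d ^ card U * card (N U))" by simp
    also have "\<dots> \<le> real r * (real r ^ card U * card (N {}))"
      using insert by (intro mult_left_mono) auto
    finally show ?case
      using insert.hyps by (simp add: mult.assoc)
  qed simp
  then show ?thesis by (simp add: N_def)
qed

text \<open>Expanding the product over \<open>T\<close> leaves the events that a subset
  \<open>U\<close> lies in the support. Nonnegative coefficients allow each probability to be
  replaced by \<open>p ^ card U\<close>, and the sum folds back into a binomial moment generating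
  function.\<close>

lemma sjl_columns_hit_mgf:
  fixes \<theta> :: real
  assumes "T \<subseteq> {..<d}" "0 < r" "r \<le> d" "\<theta> \<ge> 0"
  shows "measure_pmf.expectation (pmf_of_set (sjl_columns d r))
      (\<lambda>v. exp (\<theta> * card {l\<in>T. v l \<noteq> 0})) \<le> (1 + r / d * (exp \<theta> - 1)) ^ card T"
proof -
  define C where "C = sjl_columns d r"
  define p where "p = real r / real d"
  have C: "finite C" "C \<noteq> {}" "card C > 0"
    using finite_sjl_columns sjl_columns_nonempty assms by (auto simp: C_def card_gt_0_iff)
  have finT: "finite T" using assms(1) finite_subset by blast
  have d0: "real d > 0" using assms by simp
  define e where "e = exp \<theta> - 1"
  have e0: "e \<ge> 0" using assms by (simp add: e_def)
  have "(\<Sum>v\<in>C. exp (\<theta> * card {l\<in>T. v l \<noteq> 0}))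
      = (\<Sum>v\<in>C. \<Sum>U\<in>Pow T. e ^ card U * (if \<forall>l\<in>U. v l \<noteq> 0 then 1 else 0))"
  proof (intro sum.cong refl)
    fix v :: "nat \<Rightarrow> real"
    have "exp (\<theta> * card {l\<in>T. v l \<noteq> 0}) = (\<Prod>l\<in>T. (if v l \<noteq> 0 then exp \<theta> else 1))"
      using finT
      by (simp add: prod.If_cases exp_of_nat_mult[symmetric] Int_def mult.commute)
    also have "\<dots> = (\<Prod>l\<in>T. e * (if v l \<noteq> 0 then 1 else 0) + 1)"
      by (intro prod.cong) (auto simp: e_def)
    also have "\<dots> = (\<Sum>U\<in>Pow T. \<Prod>l\<in>U. e * (if v l \<noteq> 0 then 1 else 0))"
      by (subst prod_add[OF finT]) simp
    also have "\<dots> = (\<Sum>U\<in>Pow T. e ^ card U * (if \<forall>l\<in>U. v l \<noteq> 0 then 1 else 0))"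
    proof (intro sum.cong refl)
      fix U assume "U \<in> Pow T"
      then have "finite U" using finT finite_subset by auto
      then show "(\<Prod>l\<in>U. e * (if v l \<noteq> 0 then 1 else 0))
          = e ^ card U * (if \<forall>l\<in>U. v l \<noteq> 0 then 1 else 0)"
        by (auto simp: prod.distrib)
    qed
    finally show "exp (\<theta> * card {l\<in>T. v l \<noteq> 0})
      = (\<Sum>U\<in>Pow T. e ^ card U * (if \<forall>l\<in>U. v l \<noteq> 0 then 1 else 0))" .
  qed
  also have "\<dots> = (\<Sum>U\<in>Pow T. e ^ card U * card {v\<in>C. \<forall>l\<in>U. v l \<noteq> 0})"
    using C(1) by (subst sum.swap) (simp add: sum.If_cases Int_def flip: sum_distrib_left)
  also have "\<dots> \<le> (\<Sum>U\<in>Pow T. e ^ card U * (p ^ card U * card C))"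
  proof (intro sum_mono mult_left_mono)
    fix U assume "U \<in> Pow T"
    then have "real d ^ card U * card {v\<in>C. \<forall>l\<in>U. v l \<noteq> 0} \<le> real r ^ card U * card C"
      unfolding C_def using assms by (intro card_sjl_columns_superset) auto
    then show "card {v\<in>C. \<forall>l\<in>U. v l \<noteq> 0} \<le> p ^ card U * card C"
      using d0 by (simp add: p_def power_divide field_simps)
  qed (use e0 in auto)
  also have "\<dots> = (\<Sum>U\<in>Pow T. \<Prod>l\<in>U. p * e) * card C"
    by (simp add: sum_distrib_left power_mult_distrib mult_ac)
  also have "(\<Sum>U\<in>Pow T. \<Prod>l\<in>U. p * e) = (1 + p * e) ^ card T"
    using prod_add[OF finT, of "\<lambda>_. p * e" "\<lambda>_. 1"] by (simp add: add.commute)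
  finally show ?thesis
    using C by (simp add: integral_pmf_of_set p_def e_def C_def[symmetric] field_simps)
qed

text \<open>For fixed \<open>w\<close> the sum is the number of common support rows divided by
  \<open>(real r)\<^sup>2\<close>. The upper bound on \<theta> makes the rescaled parameter \<eta>
  at most 1, where \<open>exp \<eta> - 1 \<le> 2 * \<eta>\<close>.\<close>

lemma sjl_columns_overlap_mgf:
  assumes "w \<in> sjl_columns d r" "0 < r" "r \<le> d" "0 \<le> \<theta>" "\<theta> \<le> (real r)\<^sup>2"
  shows "measure_pmf.expectation (pmf_of_set (sjl_columns d r))
      (\<lambda>v. exp (\<theta> * (\<Sum>l<d. (v l)\<^sup>2 * (w l)\<^sup>2))) \<le> exp (2 * \<theta> / d)"
proof -
  define T where "T = {l. w l \<noteq> 0}"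
  define \<eta> where "\<eta> = \<theta> / (real r)\<^sup>2"
  have T: "T \<subseteq> {..<d}" "card T = r" "finite T"
    using sjl_columns_support[OF assms(1)] by (auto simp: T_def)
  have C: "finite (sjl_columns d r)" "sjl_columns d r \<noteq> {}"
    using finite_sjl_columns sjl_columns_nonempty assms by auto
  have eta: "0 \<le> \<eta>" "\<eta> \<le> 1"
    using assms by (auto simp: \<eta>_def)
  have "measure_pmf.expectation (pmf_of_set (sjl_columns d r))
      (\<lambda>v. exp (\<theta> * (\<Sum>l<d. (v l)\<^sup>2 * (w l)\<^sup>2)))
    = measure_pmf.expectation (pmf_of_set (sjl_columns d r))
      (\<lambda>v. exp (\<eta> * card {l\<in>T. v l \<noteq> 0}))"
  proof (intro integral_cong_AE AE_pmfI)
    fix v assume "v \<in> set_pmf (pmf_of_set (sjl_columns d r))"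
    then have v: "v \<in> sjl_columns d r" using C by simp
    have "(\<Sum>l<d. (v l)\<^sup>2 * (w l)\<^sup>2) = (\<Sum>l<d. if l \<in> {l\<in>T. v l \<noteq> 0} then (1 / r)\<^sup>2 else 0)"
      by (intro sum.cong refl)
        (auto simp: sjl_columns_power2[OF v] sjl_columns_power2[OF assms(1)] T_def power_one_over
          power2_eq_square[of "real r"])
    also have "\<dots> = card ({..<d} \<inter> {l\<in>T. v l \<noteq> 0}) * (1 / r)\<^sup>2"
      by (simp add: sum.If_cases)
    also have "{..<d} \<inter> {l\<in>T. v l \<noteq> 0} = {l\<in>T. v l \<noteq> 0}"
      using T by auto
    finally show "exp (\<theta> * (\<Sum>l<d. (v l)\<^sup>2 * (w l)\<^sup>2)) = exp (\<eta> * card {l\<in>T. v l \<noteq> 0})"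
      by (simp add: \<eta>_def power_divide)
  qed auto
  also have "\<dots> \<le> (1 + r / d * (exp \<eta> - 1)) ^ r"
    using sjl_columns_hit_mgf[OF T(1) assms(2,3) eta(1)] T by simp
  also have "\<dots> \<le> (1 + r / d * (2 * \<eta>)) ^ r"
  proof (intro power_mono add_left_mono mult_left_mono)
    have "exp \<eta> \<le> 1 + \<eta> + \<eta>\<^sup>2" using eta by (intro exp_bound) auto
    moreover have "\<eta>\<^sup>2 \<le> \<eta>" using eta by (simp add: power2_eq_square mult_left_le)
    ultimately show "exp \<eta> - 1 \<le> 2 * \<eta>" by simp
  qed (use eta in auto)
  also have "\<dots> \<le> exp (r / d * (2 * \<eta>)) ^ r"
    using eta by (intro power_mono) auto
  also have "\<dots> = exp (2 * \<theta> / d)"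
    using assms(2) by (simp add: \<eta>_def power2_eq_square flip: exp_of_nat_mult)
  finally show ?thesis .
qed

section \<open>Independent columns and symmetrisation by signs\<close>

text \<open>The number \<open>D\<close> of columns is free; it becomes \<open>2 * d\<close> when the
  two matrices of a map are placed side by side.\<close>

definition sjl_family :: "nat \<Rightarrow> nat \<Rightarrow> nat \<Rightarrow> (nat \<Rightarrow> nat \<Rightarrow> real) pmf" where
  "sjl_family D d r = Pi_pmf {..<D} (\<lambda>_. 0) (\<lambda>_. pmf_of_set (sjl_columns d r))"

lemma sjl_family_eq_pmf_of_set:
  assumes "0 < r" "r \<le> d"
  shows "sjl_family D d r = pmf_of_set (PiE_dflt {..<D} (\<lambda>_. 0) (\<lambda>_. sjl_columns d r))"
  unfolding sjl_family_def
  using assms by (intro Pi_pmf_of_set) (auto simp: finite_sjl_columns sjl_columns_nonempty)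

lemma set_sjl_family:
  assumes "0 < r" "r \<le> d"
  shows "set_pmf (sjl_family D d r) = PiE_dflt {..<D} (\<lambda>_. 0) (\<lambda>_. sjl_columns d r)"
    and "finite (PiE_dflt {..<D} (\<lambda>_. 0) (\<lambda>_. sjl_columns d r))"
    and "PiE_dflt {..<D} (\<lambda>_. 0) (\<lambda>_. sjl_columns d r) \<noteq> {}"
proof -
  show fin: "finite (PiE_dflt {..<D} (\<lambda>_. 0) (\<lambda>_. sjl_columns d r))"
    by (intro finite_PiE_dflt) (auto simp: finite_sjl_columns)
  show ne: "PiE_dflt {..<D} (\<lambda>_. 0) (\<lambda>_. sjl_columns d r) \<noteq> {}"
    using assms sjl_columns_nonempty by simp
  show "set_pmf (sjl_family D d r) = PiE_dflt {..<D} (\<lambda>_. 0) (\<lambda>_. sjl_columns d r)"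
    using fin ne by (simp add: sjl_family_eq_pmf_of_set[OF assms])
qed

text \<open>Rows come first: for fixed columns, different output coordinates use different rows of
  signs, so the expectation factorises over the rows.\<close>

definition sign_matrix :: "nat \<Rightarrow> nat \<Rightarrow> (nat \<Rightarrow> nat \<Rightarrow> real) pmf" where
  "sign_matrix D d = Pi_pmf {..<d} (\<lambda>_. 0) (\<lambda>_. Pi_pmf {..<D} 0 (\<lambda>_. rademacher))"

lemma finite_set_sign_matrix: "finite (set_pmf (sign_matrix D d))"
  unfolding sign_matrix_def by (intro finite_set_Pi_pmf) auto

lemma sign_matrix_values:
  assumes "\<sigma> \<in> set_pmf (sign_matrix D d)" "l < d" "j < D"
  shows "\<sigma> l j \<in> {- 1, 1}"
  using assms unfolding sign_matrix_def
  by (auto simp: set_Pi_pmf PiE_dflt_def)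

text \<open>Multiplication by fixed signs is an involution of the set on which the family is
  uniform.\<close>

lemma sjl_family_sign_flip:
  assumes "0 < r" "r \<le> d" and \<sigma>: "\<And>l j. l < d \<Longrightarrow> j < D \<Longrightarrow> \<sigma> l j \<in> {- 1, 1}"
  shows "map_pmf (\<lambda>c j l. \<sigma> l j * c j l) (sjl_family D d r) = sjl_family D d r"
proof -
  define P where "P = PiE_dflt {..<D} (\<lambda>_. 0) (\<lambda>_. sjl_columns d r)"
  define f where "f = (\<lambda>(c::nat \<Rightarrow> nat \<Rightarrow> real) j l. \<sigma> l j * c j l)"
  \<comment> \<open>Outside the index range \<sigma> is arbitrary, but the entries of a family are
    zero there.\<close>
  have inv: "f (f c) = c" if "c \<in> P" for c
  proof (intro ext)
    fix j l
    have "c j l = 0" if "\<not> (j < D \<and> l < d)"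
      using that \<open>c \<in> P\<close> by (cases "j < D") (auto simp: P_def PiE_dflt_def sjl_columns_def)
    then consider "j < D" "l < d" | "c j l = 0" by blast
    then show "f (f c) j l = c j l"
      using \<sigma>[of l j] by cases (auto simp: f_def)
  qed
  have closed: "f c \<in> P" if c: "c \<in> P" for c
  proof -
    have "f c j \<in> sjl_columns d r" if j: "j < D" for j
    proof -
      have cj: "c j \<in> sjl_columns d r"
        using c j by (auto simp: P_def PiE_dflt_def)
      have out: "c j l = 0" if "l \<ge> d" for l
        using cj that by (auto simp: sjl_columns_def)
      have val: "f c j l \<in> {c j l, - c j l}" for l
        using \<sigma>[of l j] j out[of l] by (cases "l < d") (auto simp: f_def)
      have "{l. f c j l \<noteq> 0} = {l. c j l \<noteq> 0}"
        using val by (metis (lifting) insertE neg_equal_0_iff_equal singletonD)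
      moreover have "f c j l \<in> {- (1 / sqrt r), 0, 1 / sqrt r}" for l
      proof -
        have "c j l \<in> {- (1 / sqrt r), 0, 1 / sqrt r}"
          using cj by (simp add: sjl_columns_def)
        then show ?thesis using val[of l] by auto
      qed
      moreover have "f c j l = 0" if "l \<ge> d" for l
        using out[OF that] by (simp add: f_def)
      ultimately show ?thesis
        using cj by (simp add: sjl_columns_def)
    qed
    then show ?thesis
      using c by (auto simp: P_def PiE_dflt_def f_def)
  qed
  have "bij_betw f P P"
    by (rule bij_betw_byWitness[where f' = f]) (auto simp: inv closed)
  then show ?thesis
    using set_sjl_family(2,3)[OF assms(1,2), of D]
    unfolding sjl_family_eq_pmf_of_set[OF assms(1,2)] P_def f_def
    by (intro map_pmf_of_set_bij_betw)
qed

text \<open>Introduces fresh signs independent of the columns, so that the columns can be held fixed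
  while the signs are averaged. Invariance holds for each \<sigma>; the rest exchanges two
  expectations.\<close>

lemma sjl_family_symmetrise:
  fixes F :: "(nat \<Rightarrow> nat \<Rightarrow> real) \<Rightarrow> real"
  assumes "0 < r" "r \<le> d"
  shows "measure_pmf.expectation (sjl_family D d r) F =
    measure_pmf.expectation (sjl_family D d r) (\<lambda>c.
      measure_pmf.expectation (sign_matrix D d) (\<lambda>\<sigma>. F (\<lambda>j l. \<sigma> l j * c j l)))"
proof -
  let ?P = "sjl_family D d r" and ?S = "sign_matrix D d"
  have fin: "finite (set_pmf ?P)" "finite (set_pmf ?S)"
    using set_sjl_family[OF assms, of D] finite_set_sign_matrix by auto
  have "measure_pmf.expectation ?P F =
      measure_pmf.expectation ?S (\<lambda>\<sigma>. measure_pmf.expectation ?P F)"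
    by simp
  also have "\<dots> = measure_pmf.expectation ?S (\<lambda>\<sigma>.
      measure_pmf.expectation ?P (\<lambda>c. F (\<lambda>j l. \<sigma> l j * c j l)))"
  proof (rule integral_cong_AE; (rule AE_pmfI)?)
    fix \<sigma> assume "\<sigma> \<in> set_pmf ?S"
    then have "map_pmf (\<lambda>c j l. \<sigma> l j * c j l) ?P = ?P"
      using assms sign_matrix_values by (intro sjl_family_sign_flip) auto
    then show "measure_pmf.expectation ?P F =
        measure_pmf.expectation ?P (\<lambda>c. F (\<lambda>j l. \<sigma> l j * c j l))"
      using integral_map_pmf[of "\<lambda>c j l. \<sigma> l j * c j l" ?P F] by simp
  qed auto
  also have "\<dots> = measure_pmf.expectation (pair_pmf ?S ?P) (\<lambda>(\<sigma>, c). F (\<lambda>j l. \<sigma> l j * c j l))"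
    using fin by (simp add: expectation_pair_pmf_finite)
  also have "\<dots> = measure_pmf.expectation (pair_pmf ?P ?S) (\<lambda>(c, \<sigma>). F (\<lambda>j l. \<sigma> l j * c j l))"
    by (subst pair_commute_pmf) (simp add: case_prod_unfold)
  also have "\<dots> = measure_pmf.expectation ?P (\<lambda>c.
      measure_pmf.expectation ?S (\<lambda>\<sigma>. F (\<lambda>j l. \<sigma> l j * c j l)))"
    using fin by (simp add: expectation_pair_pmf_finite)
  finally show ?thesis .
qed

text \<open>Column \<open>i\<close> is split off and averaged with the others fixed; as
  \<open>i \<noteq> j\<close>, column \<open>j\<close> is then a constant.\<close>

lemma sjl_family_pair_mgf:
  assumes "i < D" "j < D" "i \<noteq> j" "0 < r" "r \<le> d" "0 \<le> \<theta>" "\<theta> \<le> (real r)\<^sup>2"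
  shows "measure_pmf.expectation (sjl_family D d r)
      (\<lambda>c. exp (\<theta> * (\<Sum>l<d. (c i l)\<^sup>2 * (c j l)\<^sup>2))) \<le> exp (2 * \<theta> / d)"
proof -
  let ?C = "pmf_of_set (sjl_columns d r)"
  define Q where "Q = Pi_pmf ({..<D} - {i}) (\<lambda>_. 0) (\<lambda>_. ?C)"
  have C: "finite (set_pmf ?C)" "set_pmf ?C = sjl_columns d r"
    using finite_sjl_columns sjl_columns_nonempty[OF assms(4,5)] by auto
  have finQ: "finite (set_pmf Q)"
    unfolding Q_def using C by (intro finite_set_Pi_pmf) auto
  have Qj: "c j \<in> sjl_columns d r" if "c \<in> set_pmf Q" for c
    using that assms(2,3) C by (auto simp: Q_def set_Pi_pmf PiE_dflt_def)
  have "insert i ({..<D} - {i}) = {..<D}" using assms by auto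
  then have "sjl_family D d r = map_pmf (\<lambda>(v, c). c(i := v)) (pair_pmf ?C Q)"
    unfolding sjl_family_def Q_def
    by (subst Pi_pmf_insert[symmetric]) auto
  also have "\<dots> = map_pmf (\<lambda>(c, v). c(i := v)) (pair_pmf Q ?C)"
    by (subst pair_commute_pmf) (simp add: map_pmf_comp case_prod_unfold)
  finally have "measure_pmf.expectation (sjl_family D d r)
      (\<lambda>c. exp (\<theta> * (\<Sum>l<d. (c i l)\<^sup>2 * (c j l)\<^sup>2)))
    = measure_pmf.expectation (pair_pmf Q ?C)
      (\<lambda>(c, v). exp (\<theta> * (\<Sum>l<d. (v l)\<^sup>2 * (c j l)\<^sup>2)))"
    using assms(3) by (simp add: case_prod_unfold)
  also have "\<dots> = measure_pmf.expectation Q (\<lambda>c. measure_pmf.expectation ?C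
      (\<lambda>v. exp (\<theta> * (\<Sum>l<d. (v l)\<^sup>2 * (c j l)\<^sup>2))))"
    using finQ C by (subst expectation_pair_pmf_finite) auto
  also have "\<dots> \<le> measure_pmf.expectation Q (\<lambda>c. exp (2 * \<theta> / d))"
    using assms Qj by (intro expectation_mono_pmf_finite finQ sjl_columns_overlap_mgf) auto
  finally show ?thesis by simp
qed

lemma sjl_family_mgf:
  fixes u :: "nat \<Rightarrow> real"
  assumes "0 < r" "r \<le> d" and unit: "(\<Sum>j<D. (u j)\<^sup>2) = 1" and lam: "4 * \<bar>\<nu>\<bar> \<le> r"
  shows "measure_pmf.expectation (sjl_family D d r)
      (\<lambda>c. exp (\<nu> * ((\<Sum>l<d. (\<Sum>j<D. c j l * u j)\<^sup>2) - 1))) \<le> exp (8 * \<nu>\<^sup>2 / d)"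
proof -
  let ?P = "sjl_family D d r" and ?S = "sign_matrix D d"
  let ?I = "{..<D} \<times> {..<D}"
  \<comment> \<open>Diagonal pairs contribute 0 but stay in the index set, so that the weights
    \<open>w\<close> sum to 1 for Jensen's inequality.\<close>
  define q where "q = (\<lambda>(c::nat \<Rightarrow> nat \<Rightarrow> real) (i, j).
    if i = j then 0 else (\<Sum>l<d. (c i l)\<^sup>2 * (c j l)\<^sup>2))"
  define w where "w = (\<lambda>(i, j). (u i)\<^sup>2 * (u j)\<^sup>2)"
  have fin: "finite (set_pmf ?P)"
    using set_sjl_family[OF assms(1,2), of D] by auto
  have col: "c j \<in> sjl_columns d r" if "c \<in> set_pmf ?P" "j < D" for c j
    using that set_sjl_family(1)[OF assms(1,2), of D] by (auto simp: PiE_dflt_def)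
  have D0: "D > 0" using unit by (cases D) auto
  have w1: "sum w ?I = 1"
  proof -
    have "sum w ?I = (\<Sum>i<D. (u i)\<^sup>2) * (\<Sum>j<D. (u j)\<^sup>2)"
      by (simp add: w_def sum_product sum.cartesian_product)
    then show ?thesis using unit by simp
  qed
  have w0: "w p \<ge> 0" for p by (cases p) (simp add: w_def)
  have sign: "measure_pmf.expectation ?S
      (\<lambda>\<sigma>. exp (\<nu> * ((\<Sum>l<d. (\<Sum>j<D. \<sigma> l j * c j l * u j)\<^sup>2) - 1)))
      \<le> exp (4 * \<nu>\<^sup>2 * (\<Sum>p\<in>?I. w p * q c p))" if c: "c \<in> set_pmf ?P" for c
  proof -
    define b where "b = (\<lambda>l j. c j l * u j)"
    define V where "V = (\<lambda>l. \<Sum>j<D. (b l j)\<^sup>2)"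
    have sumV: "(\<Sum>l<d. V l) = 1"
    proof -
      have "(\<Sum>l<d. V l) = (\<Sum>j<D. (u j)\<^sup>2 * (\<Sum>l<d. (c j l)\<^sup>2))"
        unfolding V_def b_def
        by (subst sum.swap) (simp add: power_mult_distrib sum_distrib_left mult_ac)
      also have "\<dots> = (\<Sum>j<D. (u j)\<^sup>2)"
        using sjl_columns_norm[OF col[OF c] assms(1)] by simp
      finally show ?thesis using unit by simp
    qed
    have V0: "V l \<ge> 0" for l unfolding V_def by (intro sum_nonneg) auto
    have Vr: "V l \<le> 1 / r" for l
    proof -
      have "V l \<le> (\<Sum>j<D. 1 / r * (u j)\<^sup>2)"
        unfolding V_def b_def power_mult_distrib
        using sjl_columns_power2[OF col[OF c]] by (intro sum_mono mult_right_mono) auto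
      also have "\<dots> = 1 / r"
        using unit by (simp flip: sum_divide_distrib)
      finally show ?thesis .
    qed
    \<comment> \<open>Here the bound on \<nu> enters: the denominator in
      \<open>rademacher_chaos_mgf\<close> is at least 1/2, whence the coefficient
      \<open>4 * \<nu>\<^sup>2\<close>.\<close>
    have half: "2 * \<bar>\<nu>\<bar> * V l \<le> 1 / 2" for l
    proof -
      have "2 * \<bar>\<nu>\<bar> * V l \<le> (r / 2) * (1 / r)"
        using lam V0 Vr by (intro mult_mono) auto
      then show ?thesis using assms(1) by simp
    qed
    have "measure_pmf.expectation ?S
        (\<lambda>\<sigma>. exp (\<nu> * ((\<Sum>l<d. (\<Sum>j<D. \<sigma> l j * c j l * u j)\<^sup>2) - 1)))
      = measure_pmf.expectation ?S
        (\<lambda>\<sigma>. \<Prod>l<d. exp (\<nu> * ((\<Sum>j<D. \<sigma> l j * b l j)\<^sup>2 - V l)))"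
      by (simp add: b_def mult.assoc sumV sum_subtractf right_diff_distrib
          flip: exp_sum sum_distrib_left)
    also have "\<dots> = (\<Prod>l<d. measure_pmf.expectation (Pi_pmf {..<D} 0 (\<lambda>_. rademacher))
        (\<lambda>s. exp (\<nu> * ((\<Sum>j<D. s j * b l j)\<^sup>2 - V l))))"
      unfolding sign_matrix_def
      by (intro expectation_prod_Pi_pmf integrable_measure_pmf_finite finite_set_Pi_pmf) auto
    also have "\<dots> \<le> (\<Prod>l<d. exp (4 * \<nu>\<^sup>2 * ((V l)\<^sup>2 - (\<Sum>j<D. (b l j) ^ 4))))"
    proof (intro prod_mono conjI)
      fix l
      show "0 \<le> measure_pmf.expectation (Pi_pmf {..<D} 0 (\<lambda>_. rademacher))
        (\<lambda>s. exp (\<nu> * ((\<Sum>j<D. s j * b l j)\<^sup>2 - V l)))"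
        by simp
      have "(\<Sum>j<D. ((b l j)\<^sup>2)\<^sup>2) \<le> (V l)\<^sup>2"
        unfolding V_def by (intro sum_power2_le_power2_sum) auto
      then have VW: "(V l)\<^sup>2 - (\<Sum>j<D. (b l j) ^ 4) \<ge> 0"
        by simp
      have lt1: "2 * \<bar>\<nu>\<bar> * V l < 1" using half[of l] by simp
      have "\<bar>\<nu> / (1 - 2 * \<bar>\<nu>\<bar> * V l)\<bar> \<le> \<bar>\<nu>\<bar> / (1 / 2)"
        using half[of l] by (simp add: abs_divide) (intro frac_le[of "\<bar>\<nu>\<bar>" _ "1 / 2", simplified], auto)
      then have "(\<nu> / (1 - 2 * \<bar>\<nu>\<bar> * V l))\<^sup>2 \<le> (2 * \<nu>)\<^sup>2"
        by (intro abs_le_square_iff[THEN iffD1]) (simp add: abs_mult)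
      then have coef: "(\<nu> / (1 - 2 * \<bar>\<nu>\<bar> * V l))\<^sup>2 \<le> 4 * \<nu>\<^sup>2"
        by (simp add: power_mult_distrib)
      have "measure_pmf.expectation (Pi_pmf {..<D} 0 (\<lambda>_. rademacher))
          (\<lambda>s. exp (\<nu> * ((\<Sum>j<D. s j * b l j)\<^sup>2 - V l)))
        \<le> exp ((\<nu> / (1 - 2 * \<bar>\<nu>\<bar> * V l))\<^sup>2 * ((V l)\<^sup>2 - (\<Sum>j<D. (b l j) ^ 4)))"
        using rademacher_chaos_mgf[of "{..<D}" \<nu> "b l"] lt1 by (simp add: V_def)
      also have "\<dots> \<le> exp (4 * \<nu>\<^sup>2 * ((V l)\<^sup>2 - (\<Sum>j<D. (b l j) ^ 4)))"
        using mult_right_mono[OF coef VW] by simp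
      finally show "measure_pmf.expectation (Pi_pmf {..<D} 0 (\<lambda>_. rademacher))
          (\<lambda>s. exp (\<nu> * ((\<Sum>j<D. s j * b l j)\<^sup>2 - V l)))
        \<le> exp (4 * \<nu>\<^sup>2 * ((V l)\<^sup>2 - (\<Sum>j<D. (b l j) ^ 4)))" .
    qed
    also have "\<dots> = exp (4 * \<nu>\<^sup>2 * (\<Sum>l<d. (V l)\<^sup>2 - (\<Sum>j<D. (b l j) ^ 4)))"
      by (simp add: sum_distrib_left flip: exp_sum)
    also have "(\<Sum>l<d. (V l)\<^sup>2 - (\<Sum>j<D. (b l j) ^ 4)) = (\<Sum>p\<in>?I. w p * q c p)"
    proof -
      have row: "(V l)\<^sup>2 - (\<Sum>j<D. (b l j) ^ 4)
          = (\<Sum>i<D. \<Sum>j<D. if i = j then 0 else (b l i)\<^sup>2 * (b l j)\<^sup>2)" for l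
      proof -
        have "(V l)\<^sup>2 = (\<Sum>i<D. \<Sum>j<D. (b l i)\<^sup>2 * (b l j)\<^sup>2)"
          by (simp add: V_def power2_eq_square sum_product)
        moreover have "(\<Sum>j<D. (b l j) ^ 4)
            = (\<Sum>i<D. \<Sum>j<D. if i = j then (b l i)\<^sup>2 * (b l j)\<^sup>2 else 0)"
          by (simp add: power4_eq_xxxx power2_eq_square mult.assoc)
        ultimately show ?thesis
          by (simp only: flip: sum_subtractf) (intro sum.cong refl, auto)
      qed
      have "(\<Sum>l<d. (V l)\<^sup>2 - (\<Sum>j<D. (b l j) ^ 4))
          = (\<Sum>i<D. \<Sum>j<D. \<Sum>l<d. if i = j then 0 else (b l i)\<^sup>2 * (b l j)\<^sup>2)"
        unfolding row by (rule trans[OF sum.swap]) (rule sum.cong[OF refl], rule sum.swap)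
      also have "\<dots> = (\<Sum>i<D. \<Sum>j<D. w (i, j) * q c (i, j))"
        by (intro sum.cong refl)
          (auto simp: w_def q_def b_def power_mult_distrib sum_distrib_left mult_ac)
      finally show ?thesis
        by (simp add: sum.cartesian_product')
    qed
    finally show ?thesis .
  qed
  have "measure_pmf.expectation ?P (\<lambda>c. exp (\<nu> * ((\<Sum>l<d. (\<Sum>j<D. c j l * u j)\<^sup>2) - 1)))
    = measure_pmf.expectation ?P (\<lambda>c. measure_pmf.expectation ?S
      (\<lambda>\<sigma>. exp (\<nu> * ((\<Sum>l<d. (\<Sum>j<D. \<sigma> l j * c j l * u j)\<^sup>2) - 1))))"
    by (rule sjl_family_symmetrise[OF assms(1,2)])
  also have "\<dots> \<le> measure_pmf.expectation ?P (\<lambda>c. \<Sum>p\<in>?I. w p * exp (4 * \<nu>\<^sup>2 * q c p))"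
  proof (intro expectation_mono_pmf_finite[OF fin] order_trans[OF sign])
    fix c
    \<comment> \<open>Convexity of exp replaces the joint law of all overlaps by the laws of single
      pairs.\<close>
    have "exp (\<Sum>p\<in>?I. w p *\<^sub>R (4 * \<nu>\<^sup>2 * q c p)) \<le> (\<Sum>p\<in>?I. w p * exp (4 * \<nu>\<^sup>2 * q c p))"
      using w1 w0 D0 by (intro convex_on_sum[OF _ _ exp_convex]) auto
    then show "exp (4 * \<nu>\<^sup>2 * (\<Sum>p\<in>?I. w p * q c p)) \<le> (\<Sum>p\<in>?I. w p * exp (4 * \<nu>\<^sup>2 * q c p))"
      by (simp add: sum_distrib_left mult_ac)
  qed
  also have "\<dots> = (\<Sum>p\<in>?I. w p * measure_pmf.expectation ?P (\<lambda>c. exp (4 * \<nu>\<^sup>2 * q c p)))"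
    using fin by (subst Bochner_Integration.integral_sum)
      (auto intro!: integrable_measure_pmf_finite)
  also have "\<dots> \<le> (\<Sum>p\<in>?I. w p * exp (8 * \<nu>\<^sup>2 / d))"
  proof (intro sum_mono mult_left_mono w0)
    fix p assume p: "p \<in> ?I"
    obtain i j where ij: "p = (i, j)" by (cases p)
    have "4 * \<nu>\<^sup>2 \<le> (4 * \<bar>\<nu>\<bar>)\<^sup>2"
      by (simp add: power_mult_distrib)
    also have "\<dots> \<le> (real r)\<^sup>2"
      using lam by (intro power_mono) auto
    \<comment> \<open>A diagonal term is \<open>exp 0\<close>; off the diagonal the pair bound
      applies with parameter \<open>4 * \<nu>\<^sup>2\<close>.\<close>
    finally show "measure_pmf.expectation ?P (\<lambda>c. exp (4 * \<nu>\<^sup>2 * q c p)) \<le> exp (8 * \<nu>\<^sup>2 / d)"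
      using sjl_family_pair_mgf[of i D j r d "4 * \<nu>\<^sup>2"] assms(1,2) p
      by (cases "i = j") (auto simp: ij q_def)
  qed
  also have "\<dots> = exp (8 * \<nu>\<^sup>2 / d)"
    using w1 by (simp flip: sum_distrib_right)
  finally show ?thesis .
qed

section \<open>Chernoff bounds for one map\<close>

lemma Chernoff_pmf_finite:
  fixes f :: "'a \<Rightarrow> real"
  assumes "finite (set_pmf p)" "measure_pmf.expectation p (\<lambda>x. exp (f x)) \<le> B"
  shows "measure_pmf.prob p {x. f x \<ge> a} \<le> B * exp (- a)"
proof -
  have "measure_pmf.prob p {x. exp (f x) \<ge> exp a}
      \<le> measure_pmf.expectation p (\<lambda>x. exp (f x)) / exp a"
    using integral_Markov_inequality_measure[of "measure_pmf p" "\<lambda>x. exp (f x)" UNIV "exp a"]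
      assms(1) by (auto intro: integrable_measure_pmf_finite)
  also have "\<dots> \<le> B * exp (- a)"
    using assms(2) by (simp add: exp_minus field_simps)
  finally show ?thesis by simp
qed

text \<open>Rescaling to a unit vector turns the deviation into \<open>N * Z c\<close>. The zero
  vector is treated apart; its event is empty.\<close>

lemma sjl_family_tail:
  fixes u :: "nat \<Rightarrow> real" and D :: nat
  defines "N \<equiv> (\<Sum>j<D. (u j)\<^sup>2)"
  assumes r: "0 < r" "r \<le> d" and "0 < \<epsilon>" "0 \<le> L"
    and d: "32 * L \<le> real d * \<epsilon>\<^sup>2" and rL: "8 * L \<le> real r * \<epsilon>"
  shows "measure_pmf.prob (sjl_family D d r)
      {c. \<bar>(\<Sum>l<d. (\<Sum>j<D. c j l * u j)\<^sup>2) - N\<bar> > \<epsilon> * N} \<le> 2 * exp (- L)"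
proof (cases "N = 0")
  case True
  then have "\<forall>j<D. u j = 0"
    unfolding N_def by (subst (asm) sum_nonneg_eq_0_iff) auto
  then show ?thesis using True by simp
next
  case False
  let ?P = "sjl_family D d r"
  have N0: "N > 0"
    using False sum_nonneg[of "{..<D}" "\<lambda>j. (u j)\<^sup>2"] by (simp add: N_def)
  define u' where "u' = (\<lambda>j. u j / sqrt N)"
  define Z where "Z = (\<lambda>c::nat \<Rightarrow> nat \<Rightarrow> real. (\<Sum>l<d. (\<Sum>j<D. c j l * u' j)\<^sup>2) - 1)"
  have unit: "(\<Sum>j<D. (u' j)\<^sup>2) = 1"
    using N0 by (simp add: u'_def power_divide N_def flip: sum_divide_distrib)
  have Z: "(\<Sum>l<d. (\<Sum>j<D. c j l * u j)\<^sup>2) - N = N * Z c" for c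
  proof -
    have "(\<Sum>j<D. c j l * u' j)\<^sup>2 = (\<Sum>j<D. c j l * u j)\<^sup>2 / N" for l
      using N0 by (simp add: u'_def power_divide flip: sum_divide_distrib)
    then show ?thesis
      using N0 by (simp add: Z_def right_diff_distrib flip: sum_divide_distrib)
  qed
  \<comment> \<open>With this choice the threshold \<epsilon> becomes an exponent of
    \<open>2 * L\<close>, hypothesis \<open>d\<close> keeps the moment bound below
    \<open>exp L\<close>, and \<open>rL\<close> says exactly
    \<open>4 * \<nu> \<le> r\<close>.\<close>
  define \<nu> where "\<nu> = 2 * L / \<epsilon>"
  have nu: "0 \<le> \<nu>" "4 * \<nu> \<le> r" "\<nu> * \<epsilon> = 2 * L"
    using assms by (auto simp: \<nu>_def field_simps)
  have d0: "real d > 0" using r by simp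
  have "8 * \<nu>\<^sup>2 / d \<le> L"
  proof -
    have "8 * \<nu>\<^sup>2 * \<epsilon>\<^sup>2 = 32 * L * L"
      using nu(3) by (metis (no_types, lifting) mult.assoc mult.left_commute mult_2_right
        numeral_Bit0 power2_eq_square power_mult_distrib distrib_right)
    also have "\<dots> \<le> real d * \<epsilon>\<^sup>2 * L"
      using d assms(5) by (intro mult_right_mono) auto
    finally have "8 * \<nu>\<^sup>2 \<le> real d * L"
      using assms(4) by (simp add: mult.assoc mult.commute[of "\<epsilon>\<^sup>2"] flip: mult.assoc)
    then show ?thesis using d0 by (simp add: field_simps)
  qed
  then have e: "exp (8 * \<nu>\<^sup>2 / d) \<le> exp L" by simp
  have fin: "finite (set_pmf ?P)"
    using set_sjl_family[OF r, of D] by auto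
  \<comment> \<open>Both tails at once: \<open>s\<close> is \<nu> for the upper and
    \<open>- \<nu>\<close> for the lower one.\<close>
  have tail: "measure_pmf.prob ?P {c. s * Z c \<ge> 2 * L} \<le> exp (- L)"
    if "\<bar>s\<bar> = \<nu>" for s
  proof -
    have "s\<^sup>2 = \<nu>\<^sup>2" using that by (metis power2_abs)
    then have "measure_pmf.expectation ?P (\<lambda>c. exp (s * Z c)) \<le> exp (8 * \<nu>\<^sup>2 / d)"
      using sjl_family_mgf[OF r unit, of s] that nu unfolding Z_def by simp
    also note e
    finally have "measure_pmf.expectation ?P (\<lambda>c. exp (s * Z c)) \<le> exp L" .
    then have "measure_pmf.prob ?P {c. s * Z c \<ge> 2 * L} \<le> exp L * exp (- (2 * L))"
      by (rule Chernoff_pmf_finite[OF fin])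
    then show ?thesis by (simp flip: exp_add)
  qed
  have "{c. \<bar>N * Z c\<bar> > \<epsilon> * N} \<subseteq> {c. \<nu> * Z c \<ge> 2 * L} \<union> {c. - \<nu> * Z c \<ge> 2 * L}"
  proof
    fix c assume "c \<in> {c. \<bar>N * Z c\<bar> > \<epsilon> * N}"
    then have "\<bar>Z c\<bar> > \<epsilon>" using N0 by (simp add: abs_mult mult.commute)
    then have "\<nu> * \<epsilon> \<le> \<nu> * \<bar>Z c\<bar>"
      using nu(1) by (intro mult_left_mono) auto
    then show "c \<in> {c. \<nu> * Z c \<ge> 2 * L} \<union> {c. - \<nu> * Z c \<ge> 2 * L}"
      by (auto simp: nu(3) abs_if split: if_splits)
  qed
  then have "measure_pmf.prob ?P {c. \<bar>N * Z c\<bar> > \<epsilon> * N}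
      \<le> measure_pmf.prob ?P ({c. \<nu> * Z c \<ge> 2 * L} \<union> {c. - \<nu> * Z c \<ge> 2 * L})"
    by (intro measure_pmf.finite_measure_mono) auto
  also have "\<dots> \<le> measure_pmf.prob ?P {c. \<nu> * Z c \<ge> 2 * L}
      + measure_pmf.prob ?P {c. - \<nu> * Z c \<ge> 2 * L}"
    by (intro measure_Un_le) auto
  also have "\<dots> \<le> 2 * exp (- L)"
    using tail[of \<nu>] tail[of "- \<nu>"] nu(1) by simp
  finally show ?thesis unfolding Z .
qed

section \<open>Column families and pairs of matrices\<close>

text \<open>Applying the pair to two vectors amounts to one matrix with \<open>2 * d\<close> columns
  acting on their concatenation.\<close>

definition sjl_pair :: "nat \<Rightarrow> (nat \<Rightarrow> nat \<Rightarrow> real) \<Rightarrow> real mat \<times> real mat" where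
  "sjl_pair d c = (mat d d (\<lambda>(i, j). c j i), mat d d (\<lambda>(i, j). c (d + j) i))"

lemma bij_betw_sjl_pair:
  "bij_betw (sjl_pair d) (PiE_dflt {..<2 * d} (\<lambda>_. 0) (\<lambda>_. sjl_columns d r))
     (sjl_matrices d r \<times> sjl_matrices d r)"
proof -
  \<comment> \<open>The inverse pads with zeros outside the index range, matching the default value
    of the families.\<close>
  define g where "g = (\<lambda>(A::real mat, B::real mat) j l. if l < d \<and> j < 2 * d
    then (if j < d then A $$ (l, j) else B $$ (l, j - d)) else 0)"
  have mat: "mat d d (\<lambda>(i, j). c (h j) i) \<in> sjl_matrices d r"
    if "\<And>j. j < d \<Longrightarrow> c (h j) \<in> sjl_columns d r" for c :: "nat \<Rightarrow> nat \<Rightarrow> real" and h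
  proof -
    have "card {i. i < d \<and> mat d d (\<lambda>(i, j). c (h j) i) $$ (i, j) \<noteq> 0} = r" if "j < d" for j
    proof -
      note c = \<open>\<And>j. j < d \<Longrightarrow> c (h j) \<in> sjl_columns d r\<close>[OF that]
      have "{i. i < d \<and> mat d d (\<lambda>(i, j). c (h j) i) $$ (i, j) \<noteq> 0} = {i. c (h j) i \<noteq> 0}"
        using sjl_columns_support(1)[OF c] that by auto
      then show ?thesis using sjl_columns_support(3)[OF c] by simp
    qed
    moreover have "c (h j) i \<in> {- (1 / sqrt r), 0, 1 / sqrt r}" if "j < d" for i j
      using \<open>\<And>j. j < d \<Longrightarrow> c (h j) \<in> sjl_columns d r\<close>[OF that] by (simp add: sjl_columns_def)
    ultimately show ?thesis
      unfolding sjl_matrices_def by auto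
  qed
  have col: "(\<lambda>l. if l < d then A $$ (l, j) else 0) \<in> sjl_columns d r"
    if "A \<in> sjl_matrices d r" "j < d" for A j
  proof -
    have "{l. (if l < d then A $$ (l, j) else 0) \<noteq> 0} = {i. i < d \<and> A $$ (i, j) \<noteq> 0}"
      by auto
    then show ?thesis
      using that by (auto simp: sjl_matrices_def sjl_columns_def)
  qed
  show ?thesis
  proof (rule bij_betw_byWitness[where f' = g]; safe?)
    fix c assume c: "c \<in> PiE_dflt {..<2 * d} (\<lambda>_. 0) (\<lambda>_. sjl_columns d r)"
    have "c j l = 0" if "\<not> (l < d \<and> j < 2 * d)" for j l
      using c that by (cases "j < 2 * d") (auto simp: PiE_dflt_def sjl_columns_def)
    then show "g (sjl_pair d c) = c"
      by (intro ext) (auto simp: g_def sjl_pair_def)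
  next
    fix A B assume "A \<in> sjl_matrices d r" "B \<in> sjl_matrices d r"
    then show "sjl_pair d (g (A, B)) = (A, B)"
      by (auto simp: g_def sjl_pair_def sjl_matrices_def intro!: eq_matI)
  next
    fix c A B assume c: "c \<in> PiE_dflt {..<2 * d} (\<lambda>_. 0) (\<lambda>_. sjl_columns d r)"
      and AB: "(A, B) = sjl_pair d c"
    have col: "c j \<in> sjl_columns d r" if "j < 2 * d" for j
      using c that by (auto simp: PiE_dflt_def)
    show "A \<in> sjl_matrices d r" "B \<in> sjl_matrices d r"
      using AB mat[of c "\<lambda>j. j"] mat[of c "\<lambda>j. d + j"] col by (auto simp: sjl_pair_def)
  next
    fix A B assume AB: "A \<in> sjl_matrices d r" "B \<in> sjl_matrices d r"
    have "g (A, B) j \<in> sjl_columns d r" if "j < 2 * d" for j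
    proof (cases "j < d")
      case True
      then have "g (A, B) j = (\<lambda>l. if l < d then A $$ (l, j) else 0)"
        by (auto simp: g_def)
      then show ?thesis using col[OF AB(1) True] by simp
    next
      case False
      then have "g (A, B) j = (\<lambda>l. if l < d then B $$ (l, j - d) else 0)" "j - d < d"
        using that by (auto simp: g_def)
      then show ?thesis using col[OF AB(2)] by simp
    qed
    then show "g (A, B) \<in> PiE_dflt {..<2 * d} (\<lambda>_. 0) (\<lambda>_. sjl_columns d r)"
      by (auto simp: PiE_dflt_def g_def)
  qed
qed

lemma finite_sjl_matrices: "finite (sjl_matrices d r)"
proof -
  have "finite (sjl_matrices d r \<times> sjl_matrices d r)"
    using bij_betw_sjl_pair[of d r]
    by (subst bij_betw_finite[symmetric]) (auto intro!: finite_PiE_dflt finite_sjl_columns)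
  then show ?thesis by (auto simp: finite_cartesian_product_iff)
qed

lemma sjl_matrices_nonempty:
  assumes "0 < r" "r \<le> d"
  shows "sjl_matrices d r \<noteq> {}"
  using bij_betw_sjl_pair[of d r] set_sjl_family(3)[OF assms, of "2 * d"]
  by (auto simp: bij_betw_def)

text \<open>A product of uniform distributions is uniform on the product set, and a bijection
  transports it. This brings matrix pairs into the form with independent columns.\<close>

lemma sjl_dist_eq_map_sjl_family:
  assumes "0 < r" "r \<le> d"
  shows "sjl_dist d r = map_pmf (sjl_pair d) (sjl_family (2 * d) d r)"
proof -
  have "sjl_dist d r = pmf_of_set (sjl_matrices d r \<times> sjl_matrices d r)"
    using finite_sjl_matrices[of d r] sjl_matrices_nonempty[OF assms]
    by (intro pmf_eqI) (clarsimp simp: sjl_dist_def pmf_pair pmf_of_set[of "sjl_matrices d r"]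
        card_cartesian_product indicator_def)
  also have "\<dots> = map_pmf (sjl_pair d) (sjl_family (2 * d) d r)"
    unfolding sjl_family_eq_pmf_of_set[OF assms]
    using set_sjl_family(2,3)[OF assms, of "2 * d"]
    by (intro map_pmf_of_set_bij_betw[OF bij_betw_sjl_pair, symmetric]) auto
  finally show ?thesis .
qed

lemma set_sjl_dist:
  assumes "0 < r" "r \<le> d"
  shows "set_pmf (sjl_dist d r) = sjl_matrices d r \<times> sjl_matrices d r"
  using finite_sjl_matrices[of d r] sjl_matrices_nonempty[OF assms] by (simp add: sjl_dist_def)

lemma scalar_prod_self:
  fixes v :: "real vec"
  assumes "v \<in> carrier_vec n"
  shows "v \<bullet> v = (\<Sum>i<n. (v $ i)\<^sup>2)"
  using assms by (simp add: scalar_prod_def power2_eq_square atLeast0LessThan)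

lemma sjl_dist_tail:
  assumes "0 < r" "r \<le> d" "0 < \<epsilon>" "0 \<le> L" "32 * L \<le> real d * \<epsilon>\<^sup>2" "8 * L \<le> real r * \<epsilon>"
    and x: "x \<in> carrier_vec d" and y: "y \<in> carrier_vec d"
  shows "measure_pmf.prob (sjl_dist d r)
      {A. \<bar>app_map A x y \<bullet> app_map A x y - (x \<bullet> x + y \<bullet> y)\<bar> > \<epsilon> * (x \<bullet> x + y \<bullet> y)}
    \<le> 2 * exp (- L)"
proof -
  define u where "u = (\<lambda>j. if j < d then x $ j else y $ (j - d))"
  have split: "(\<Sum>j<2 * d. f j) = (\<Sum>j<d. f j) + (\<Sum>j<d. f (d + j))" for f :: "nat \<Rightarrow> real"
    using sum.nat_group[of f d 2] by (simp add: numeral_2_eq_2 add.commute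
      sum.shift_bounds_nat_ivl[of f 0 d d, simplified] atLeast0LessThan)
  have N: "(\<Sum>j<2 * d. (u j)\<^sup>2) = x \<bullet> x + y \<bullet> y"
    by (simp add: split u_def scalar_prod_self[OF x] scalar_prod_self[OF y])
  have app: "app_map (sjl_pair d c) x y \<bullet> app_map (sjl_pair d c) x y
      = (\<Sum>l<d. (\<Sum>j<2 * d. c j l * u j)\<^sup>2)" for c
  proof -
    have car: "app_map (sjl_pair d c) x y \<in> carrier_vec d"
      using x y unfolding app_map_def sjl_pair_def fst_conv snd_conv
      by (intro add_carrier_vec mult_mat_vec_carrier) auto
    have "app_map (sjl_pair d c) x y $ l = (\<Sum>j<2 * d. c j l * u j)" if "l < d" for l
      using that x y
      by (simp add: split u_def app_map_def sjl_pair_def scalar_prod_def atLeast0LessThan)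
    then show ?thesis
      by (simp add: scalar_prod_self[OF car])
  qed
  show ?thesis
    using sjl_family_tail[OF assms(1-6), where u = u and D = "2 * d"]
    unfolding sjl_dist_eq_map_sjl_family[OF assms(1,2)] N measure_map_pmf
    by (simp add: vimage_def app)
qed

section \<open>The sketches\<close>

lemma block_carrier [simp]: "block d z j \<in> carrier_vec d"
  by (simp add: block_def)

lemma app_map_carrier:
  assumes "A \<in> carrier_mat d d \<times> carrier_mat d d"
  shows "app_map A x y \<in> carrier_vec d"
  using assms by (intro carrier_vecI) (auto simp: app_map_def)

lemma all_sketch_level_carrier:
  assumes "\<And>l. l \<in> {1..i} \<Longrightarrow> \<phi> l \<in> carrier_mat d d \<times> carrier_mat d d"
  shows "all_sketch_level d \<phi> x i j \<in> carrier_vec d"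
  using assms by (cases i) (auto intro!: app_map_carrier)

text \<open>A level reads only the maps up to its own index, which makes its vectors independent of
  the next map.\<close>

lemma all_sketch_level_cong:
  assumes "\<And>l. l \<in> {1..i} \<Longrightarrow> \<phi> l = \<phi>' l"
  shows "all_sketch_level d \<phi> x i j = all_sketch_level d \<phi>' x i j"
  using assms by (induction i arbitrary: j) auto

text \<open>Both vectors merge the same \<open>2 ^ i\<close> consecutive blocks of \<open>x\<close>:
  node \<open>q\<close> of the tree over window \<open>j\<close> begins at block
  \<open>j + (q - 1) * 2 ^ i\<close>, and \<open>q * 2 ^ i \<le> s\<close> keeps it inside the
  window.\<close>

lemma all_sketch_level_eq_single_sketch_level:
  assumes "1 \<le> j" "1 \<le> q" "q * 2 ^ i \<le> s" "m = d * s"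
  shows "all_sketch_level d \<phi> x i (j + (q - 1) * 2 ^ i)
    = single_sketch_level d \<phi> (window m d x j) i q"
  using assms
proof (induction i arbitrary: q)
  case 0
  show ?case
  proof (rule eq_vecI)
    fix l assume "l < dim_vec (single_sketch_level d \<phi> (window m d x j) 0 q)"
    then have l: "l < d" by (simp add: block_def)
    have "d * (q - 1) + l < d * (q - 1) + d" using l by simp
    also have "\<dots> = d * q" using 0 by (cases q) auto
    also have "\<dots> \<le> m" using 0 by simp
    finally have "d * (q - 1) + l < m" .
    moreover have "d * (j + (q - 1) - 1) + l = (j - 1) * d + (d * (q - 1) + l)"
      using 0 by (cases j; cases q) (simp_all add: algebra_simps)
    ultimately show "all_sketch_level d \<phi> x 0 (j + (q - 1) * 2 ^ 0) $ l
        = single_sketch_level d \<phi> (window m d x j) 0 q $ l"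
      using l by (simp add: block_def window_def add.assoc)
  qed (simp add: block_def)
next
  case (Suc i)
  obtain q' where q': "q = Suc q'" using Suc.prems by (cases q) auto
  \<comment> \<open>Child \<open>2 * q - 1\<close> starts at the same block as node
    \<open>q\<close>, child \<open>2 * q\<close> starts \<open>2 ^ i\<close> blocks later.\<close>
  have e1: "j + (q - 1) * 2 ^ Suc i = j + (2 * q - 1 - 1) * 2 ^ i"
    by (simp add: q')
  have e2: "j + (2 * q - 1 - 1) * 2 ^ i + 2 ^ i = j + (2 * q - 1) * 2 ^ i"
    by (simp add: q')
  have le: "(2 * q - 1) * 2 ^ i \<le> s" "2 * q * 2 ^ i \<le> s"
  proof -
    show *: "2 * q * 2 ^ i \<le> s" using Suc.prems by (simp add: mult_ac)
    have "(2 * q - 1) * 2 ^ i \<le> 2 * q * 2 ^ i" by (intro mult_le_mono1) simp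
    then show "(2 * q - 1) * 2 ^ i \<le> s" using * by linarith
  qed
  show ?case
    unfolding all_sketch_level.simps single_sketch_level.simps e1 e2
    using Suc.prems le by (subst (1 2) Suc.IH) auto
qed

lemma vec_linear_block:
  assumes "d * j \<le> m" "1 \<le> j"
  shows "vec_linear m d (\<lambda>z. block d z j)"
proof -
  have "d * (j - 1) + l < m" if "l < d" for l
  proof -
    have "d * (j - 1) + l < d * (j - 1) + d" using that by simp
    also have "\<dots> = d * j" using assms by (cases j) auto
    finally show ?thesis using assms by simp
  qed
  then show ?thesis
    unfolding vec_linear_def by (auto simp: block_def intro!: eq_vecI)
qed

lemma vec_linear_app_map:
  assumes A: "A \<in> carrier_mat d d \<times> carrier_mat d d"
    and f: "vec_linear m d f" and g: "vec_linear m d g"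
  shows "vec_linear m d (\<lambda>z. app_map A (f z) (g z))"
proof -
  obtain B C where BC: "A = (B, C)" "B \<in> carrier_mat d d" "C \<in> carrier_mat d d"
    using A by auto
  note fc = f[unfolded vec_linear_def] and gc = g[unfolded vec_linear_def]
  have "app_map A (f (u + v)) (g (u + v)) = app_map A (f u) (g u) + app_map A (f v) (g v)"
    if uv: "u \<in> carrier_vec m" "v \<in> carrier_vec m" for u v
  proof -
    have c: "f u \<in> carrier_vec d" "f v \<in> carrier_vec d" "g u \<in> carrier_vec d" "g v \<in> carrier_vec d"
      using fc gc uv by auto
    have "app_map A (f (u + v)) (g (u + v)) = B *\<^sub>v (f u + f v) + C *\<^sub>v (g u + g v)"
      using fc gc uv by (simp add: app_map_def BC)
    also have "\<dots> = (B *\<^sub>v f u + B *\<^sub>v f v) + (C *\<^sub>v g u + C *\<^sub>v g v)"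
      using BC c by (simp add: mult_add_distrib_mat_vec)
    also have "\<dots> = app_map A (f u) (g u) + app_map A (f v) (g v)"
      using BC c by (auto simp: app_map_def intro!: eq_vecI)
    finally show ?thesis .
  qed
  moreover have "app_map A (f (a \<cdot>\<^sub>v u)) (g (a \<cdot>\<^sub>v u)) = a \<cdot>\<^sub>v app_map A (f u) (g u)"
    if u: "u \<in> carrier_vec m" for a u
  proof -
    have c: "f u \<in> carrier_vec d" "g u \<in> carrier_vec d"
      using fc gc u by auto
    have "app_map A (f (a \<cdot>\<^sub>v u)) (g (a \<cdot>\<^sub>v u)) = B *\<^sub>v (a \<cdot>\<^sub>v f u) + C *\<^sub>v (a \<cdot>\<^sub>v g u)"
      using fc gc u by (simp add: app_map_def BC)
    also have "\<dots> = a \<cdot>\<^sub>v (B *\<^sub>v f u) + a \<cdot>\<^sub>v (C *\<^sub>v g u)"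
      using BC c by (simp add: mult_mat_vec)
    also have "\<dots> = a \<cdot>\<^sub>v app_map A (f u) (g u)"
      using BC c by (auto simp: app_map_def intro!: eq_vecI simp: algebra_simps)
    finally show ?thesis .
  qed
  ultimately show ?thesis
    unfolding vec_linear_def using app_map_carrier[OF A] by blast
qed

lemma vec_linear_single_sketch_level:
  assumes "\<And>l. l \<in> {1..i} \<Longrightarrow> \<phi> l \<in> carrier_mat d d \<times> carrier_mat d d"
    and "1 \<le> q" "d * (q * 2 ^ i) \<le> m"
  shows "vec_linear m d (\<lambda>z. single_sketch_level d \<phi> z i q)"
  using assms
proof (induction i arbitrary: q)
  case 0
  then show ?case by (simp add: vec_linear_block)
next
  case (Suc i)
  have "d * ((2 * q - 1) * 2 ^ i) \<le> d * (2 * q * 2 ^ i)"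
    by (intro mult_le_mono) auto
  also have "\<dots> = d * (q * 2 ^ Suc i)" by simp
  also have "\<dots> \<le> m" by (rule Suc.prems)
  finally have *: "d * ((2 * q - 1) * 2 ^ i) \<le> m" .
  have **: "d * (2 * q * 2 ^ i) \<le> m"
    using Suc.prems(3) by (simp add: mult_ac)
  have "vec_linear m d (\<lambda>z. single_sketch_level d \<phi> z i p)" if "p \<in> {2 * q - 1, 2 * q}" for p
    using that Suc.prems(1,2) * ** by (intro Suc.IH) (auto simp del: mult.assoc)
  then show ?case
    using Suc.prems by (auto intro!: vec_linear_app_map)
qed

text \<open>Expresses the norm of a window through the level 0 blocks, from which the distortion
  accumulates.\<close>

lemma window_scalar_prod_self:
  assumes "1 \<le> j" "m = d * s"
  shows "window m d x j \<bullet> window m d x j = (\<Sum>l=j..<j + s. block d x l \<bullet> block d x l)"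
proof -
  have "window m d x j \<bullet> window m d x j = (\<Sum>p<s * d. (x $ ((j - 1) * d + p))\<^sup>2)"
    using assms by (subst scalar_prod_self[of _ m]) (auto simp: window_def mult.commute)
  also have "\<dots> = (\<Sum>q<s. \<Sum>p=q * d..<q * d + d. (x $ ((j - 1) * d + p))\<^sup>2)"
    by (rule sum.nat_group[symmetric])
  also have "\<dots> = (\<Sum>q<s. \<Sum>l<d. (x $ ((j - 1) * d + (q * d + l)))\<^sup>2)"
    by (rule sum.cong[OF refl])
      (simp add: sum.atLeastLessThan_shift_0[of _ "_ * d"] atLeast0LessThan add_ac)
  also have "\<dots> = (\<Sum>q<s. block d x (j + q) \<bullet> block d x (j + q))"
    using assms
    by (intro sum.cong refl, subst scalar_prod_self[of _ d]) (auto simp: block_def algebra_simps)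
  also have "\<dots> = (\<Sum>l=j..<j + s. block d x l \<bullet> block d x l)"
    by (simp add: sum.atLeastLessThan_shift_0 atLeast0LessThan)
  finally show ?thesis .
qed

section \<open>Distortion at one merge and over all levels\<close>

text \<open>The bad event of the union bound. It is relative to the norms of the actual inputs, so
  \<open>\<phi> (Suc i)\<close> enters only through its action on vectors fixed by the earlier
  maps.\<close>

definition distorted ::
    "real \<Rightarrow> nat \<Rightarrow> real vec \<Rightarrow> nat \<Rightarrow> nat \<Rightarrow> (nat \<Rightarrow> real mat \<times> real mat) \<Rightarrow> bool" where
  "distorted \<epsilon> d x i j \<phi> \<longleftrightarrow>
     (let a = all_sketch_level d \<phi> x i j; b = all_sketch_level d \<phi> x i (j + 2 ^ i);
          v = all_sketch_level d \<phi> x (Suc i) j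
      in \<bar>v \<bullet> v - (a \<bullet> a + b \<bullet> b)\<bar> > \<epsilon> * (a \<bullet> a + b \<bullet> b))"

text \<open>Each level costs one more factor \<open>1 - \<epsilon>\<close> or
  \<open>1 + \<epsilon>\<close>, while \<open>S\<close> splits into the sums of the two inputs. The
  condition \<open>j + 2 ^ i \<le> N + 1\<close> says that the last block covered is at most block
  \<open>N\<close>.\<close>

lemma all_sketch_level_norm_bounds:
  assumes eps: "0 \<le> \<epsilon>" "\<epsilon> \<le> 1" and "i \<le> k" "2 ^ k \<le> N"
    and good: "\<And>i j. i < k \<Longrightarrow> 1 \<le> j \<Longrightarrow> j + 2 ^ Suc i \<le> N + 1 \<Longrightarrow> \<not> distorted \<epsilon> d x i j \<phi>"
    and "1 \<le> j" "j + 2 ^ i \<le> N + 1"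
  defines "S \<equiv> \<lambda>i j. \<Sum>l=j..<j + 2 ^ i. block d x l \<bullet> block d x l"
  shows "(1 - \<epsilon>) ^ i * S i j \<le> all_sketch_level d \<phi> x i j \<bullet> all_sketch_level d \<phi> x i j
    \<and> all_sketch_level d \<phi> x i j \<bullet> all_sketch_level d \<phi> x i j \<le> (1 + \<epsilon>) ^ i * S i j"
  using assms(3,6,7)
proof (induction i arbitrary: j)
  case 0
  then show ?case by (simp add: S_def)
next
  case (Suc i)
  let ?a = "all_sketch_level d \<phi> x i j" and ?b = "all_sketch_level d \<phi> x i (j + 2 ^ i)"
  let ?v = "all_sketch_level d \<phi> x (Suc i) j"
  have S: "S (Suc i) j = S i j + S i (j + 2 ^ i)"
    unfolding S_def by (subst sum.atLeastLessThan_concat) (auto simp: mult_2 add.assoc)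
  have a: "(1 - \<epsilon>) ^ i * S i j \<le> ?a \<bullet> ?a" "?a \<bullet> ?a \<le> (1 + \<epsilon>) ^ i * S i j"
    using Suc.IH[of j] Suc.prems by auto
  have b: "(1 - \<epsilon>) ^ i * S i (j + 2 ^ i) \<le> ?b \<bullet> ?b" "?b \<bullet> ?b \<le> (1 + \<epsilon>) ^ i * S i (j + 2 ^ i)"
    using Suc.IH[of "j + 2 ^ i"] Suc.prems by auto
  have "\<not> distorted \<epsilon> d x i j \<phi>"
    using Suc.prems by (intro good) auto
  then have v: "(1 - \<epsilon>) * (?a \<bullet> ?a + ?b \<bullet> ?b) \<le> ?v \<bullet> ?v" "?v \<bullet> ?v \<le> (1 + \<epsilon>) * (?a \<bullet> ?a + ?b \<bullet> ?b)"
    unfolding distorted_def Let_def by (auto simp: algebra_simps abs_le_iff not_less)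
  have "(1 - \<epsilon>) * ((1 - \<epsilon>) ^ i * S (Suc i) j) \<le> (1 - \<epsilon>) * (?a \<bullet> ?a + ?b \<bullet> ?b)"
    using a b eps unfolding S by (intro mult_left_mono) (auto simp: algebra_simps)
  moreover have "(1 + \<epsilon>) * (?a \<bullet> ?a + ?b \<bullet> ?b) \<le> (1 + \<epsilon>) * ((1 + \<epsilon>) ^ i * S (Suc i) j)"
    using a b eps unfolding S by (intro mult_left_mono) (auto simp: algebra_simps)
  ultimately show ?case
    using v unfolding power_Suc mult.assoc by linarith
qed

lemma prob_pair_pmf_le:
  assumes "finite (set_pmf p)" "finite (set_pmf q)"
    and "\<And>y. y \<in> set_pmf q \<Longrightarrow> measure_pmf.prob p {x. E x y} \<le> B"
  shows "measure_pmf.prob (pair_pmf p q) {(x, y). E x y} \<le> B"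
proof -
  have "measure_pmf.prob (pair_pmf p q) {(x, y). E x y}
      = measure_pmf.prob (pair_pmf q p) {(y, x). E x y}"
    by (subst pair_commute_pmf) (simp add: vimage_def case_prod_unfold)
  also have "\<dots> = measure_pmf.expectation (pair_pmf q p) (indicator {(y, x). E x y})"
    by simp
  also have "\<dots> = measure_pmf.expectation q (\<lambda>y. measure_pmf.expectation p (indicator {x. E x y}))"
  proof -
    have "indicat_real {(y, x). E x y} (y, x) = indicator {x. E x y} x" for x y
      by (simp add: indicator_def)
    then show ?thesis
      using assms(1,2) by (subst expectation_pair_pmf_finite) (simp_all del: integral_indicator)
  qed
  also have "\<dots> \<le> measure_pmf.expectation q (\<lambda>y. B)"
    using assms by (intro expectation_mono_pmf_finite) auto
  finally show ?thesis by simp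
qed

lemma set_sketch_maps:
  assumes "0 < r" "r \<le> d" "\<phi> \<in> set_pmf (sketch_maps k d r)" "l \<in> {1..k}"
  shows "\<phi> l \<in> sjl_matrices d r \<times> sjl_matrices d r"
  using assms set_sjl_dist[OF assms(1,2)]
  by (auto simp: sketch_maps_def set_Pi_pmf PiE_dflt_def)

lemma sjl_matrices_carrier: "sjl_matrices d r \<subseteq> carrier_mat d d"
  by (auto simp: sjl_matrices_def)

text \<open>With \<open>\<phi> (Suc i)\<close> split off, its inputs are determined by the other
  maps, so the tail bound for fixed vectors applies conditionally.\<close>

lemma prob_distorted:
  assumes "0 < r" "r \<le> d" "0 < \<epsilon>" "0 \<le> L" "32 * L \<le> real d * \<epsilon>\<^sup>2" "8 * L \<le> real r * \<epsilon>"
    and "i < k"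
  shows "measure_pmf.prob (sketch_maps k d r) {\<phi>. distorted \<epsilon> d x i j \<phi>} \<le> 2 * exp (- L)"
proof -
  define Q where "Q = Pi_pmf ({1..k} - {Suc i}) undefined (\<lambda>_. sjl_dist d r)"
  have fin: "finite (set_pmf (sjl_dist d r))"
    using set_sjl_dist[OF assms(1,2)] finite_sjl_matrices by simp
  have finQ: "finite (set_pmf Q)"
    unfolding Q_def using fin by (intro finite_set_Pi_pmf) auto
  have "insert (Suc i) ({1..k} - {Suc i}) = {1..k}" using assms by auto
  then have eq: "sketch_maps k d r
      = map_pmf (\<lambda>(A, f). f(Suc i := A)) (pair_pmf (sjl_dist d r) Q)"
    unfolding sketch_maps_def Q_def by (subst Pi_pmf_insert[symmetric]) auto
  define a where "a f = all_sketch_level d f x i j" for f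
  define b where "b f = all_sketch_level d f x i (j + 2 ^ i)" for f
  have upd: "all_sketch_level d (f(Suc i := A)) x i j' = all_sketch_level d f x i j'" for f A j'
    by (intro all_sketch_level_cong) auto
  have dist: "distorted \<epsilon> d x i j (f(Suc i := A)) \<longleftrightarrow>
      \<bar>app_map A (a f) (b f) \<bullet> app_map A (a f) (b f) - (a f \<bullet> a f + b f \<bullet> b f)\<bar>
        > \<epsilon> * (a f \<bullet> a f + b f \<bullet> b f)" for f A
    by (simp add: distorted_def Let_def upd a_def b_def)
  have car: "a f \<in> carrier_vec d" "b f \<in> carrier_vec d" if "f \<in> set_pmf Q" for f
  proof -
    have "f l \<in> carrier_mat d d \<times> carrier_mat d d" if "l \<in> {1..i}" for l
    proof -
      have "l \<in> {1..k} - {Suc i}" using that assms(7) by auto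
      then have "f l \<in> set_pmf (sjl_dist d r)"
        using \<open>f \<in> set_pmf Q\<close> by (auto simp: Q_def set_Pi_pmf PiE_dflt_def)
      then show ?thesis
        using set_sjl_dist[OF assms(1,2)] sjl_matrices_carrier[of d r] by auto
    qed
    then show "a f \<in> carrier_vec d" "b f \<in> carrier_vec d"
      unfolding a_def b_def by (auto intro!: all_sketch_level_carrier)
  qed
  have "measure_pmf.prob (sketch_maps k d r) {\<phi>. distorted \<epsilon> d x i j \<phi>}
      = measure_pmf.prob (pair_pmf (sjl_dist d r) Q)
          {(A, f). distorted \<epsilon> d x i j (f(Suc i := A))}"
    unfolding eq measure_map_pmf by (simp add: vimage_def case_prod_unfold)
  also have "\<dots> \<le> 2 * exp (- L)"
    unfolding dist
    by (intro prob_pair_pmf_le fin finQ sjl_dist_tail assms car)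
  finally show ?thesis .
qed

section \<open>The program\<close>

lemma val_bind_tm [simp]: "val (bind_tm p f) = val (f (val p))"
  and time_bind_tm [simp]: "time (bind_tm p f) = time p + time (f (val p))"
  by (simp_all add: bind_tm_def)

lemma val_return_tm [simp]: "val (return_tm a) = a"
  and time_return_tm [simp]: "time (return_tm a) = 0"
  by (simp_all add: return_tm_def)

lemma loop_tm_append:
  "loop_tm (xs @ ys) body st = bind_tm (loop_tm xs body st) (loop_tm ys body)"
  by (induction xs arbitrary: st) (simp_all add: bind_tm_def return_tm_def)

text \<open>Each stored entry costs seven primitive operations and one loop step.\<close>

lemma time_mult_add_tm: "time (mult_add_tm E inp src dst out) = 8 * length E"
  unfolding mult_add_tm_def
  by (induction E arbitrary: out)
    (auto simp: add_tm_def mul_tm_def read_tm_def write_tm_def)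

lemma dim_mult_add_tm: "dim_vec (val (mult_add_tm E inp src dst out)) = dim_vec out"
  unfolding mult_add_tm_def
  by (induction E arbitrary: out)
    (auto simp: add_tm_def mul_tm_def read_tm_def write_tm_def)

text \<open>Following a single cell \<open>p\<close> keeps the induction local: an entry changes it
  only when \<open>dst + i = p\<close>.\<close>

lemma val_mult_add_tm:
  assumes "p < dim_vec out"
  shows "val (mult_add_tm E inp src dst out) $ p
    = out $ p + (\<Sum>(i, c, a)\<leftarrow>E. if dst + i = p then a * inp $ (src + c) else 0)"
  using assms unfolding mult_add_tm_def
  by (induction E arbitrary: out)
    (auto simp: add_tm_def mul_tm_def read_tm_def write_tm_def)

lemma sum_list_map_concat:
  fixes g :: "'a \<Rightarrow> 'b::comm_monoid_add"
  shows "sum_list (map g (concat xss)) = (\<Sum>xs\<leftarrow>xss. sum_list (map g xs))"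
  by (induction xss) auto

text \<open>Serves twice: a constant \<open>g\<close> counts the stored entries, and a product as
  \<open>g\<close> gives the matrix-vector product.\<close>

lemma sum_list_sparse_entries:
  fixes g :: "nat \<times> nat \<times> real \<Rightarrow> 'b::comm_monoid_add"
  assumes "A \<in> carrier_mat d d"
  shows "sum_list (map g (sparse_entries A))
    = (\<Sum>c<d. \<Sum>i<d. if A $$ (i, c) \<noteq> 0 then g (i, c, A $$ (i, c)) else 0)"
proof -
  have "sum_list (map g (sparse_entries A))
    = (\<Sum>c\<leftarrow>[0..<d]. \<Sum>i\<leftarrow>[0..<d]. if A $$ (i, c) \<noteq> 0 then g (i, c, A $$ (i, c)) else 0)"
    using assms unfolding sparse_entries_def
    by (auto simp: sum_list_map_concat comp_def if_distrib[of "map g"] if_distrib[of sum_list]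
        cong: if_cong)
  then show ?thesis
    by (simp add: interv_sum_list_conv_sum_set_nat atLeast0LessThan)
qed

lemma length_sparse_entries:
  assumes "A \<in> sjl_matrices d r"
  shows "length (sparse_entries A) = d * r"
proof -
  have A: "A \<in> carrier_mat d d" using assms by (simp add: sjl_matrices_def)
  have "length (sparse_entries A) = sum_list (map (\<lambda>_. 1) (sparse_entries A))"
    by (simp add: sum_list_triv)
  also have "\<dots> = (\<Sum>c<d. card {i. i < d \<and> A $$ (i, c) \<noteq> 0})"
    unfolding sum_list_sparse_entries[OF A]
    by (intro sum.cong refl) (simp add: sum.If_cases Int_def)
  also have "\<dots> = d * r"
    using assms by (simp add: sjl_matrices_def)
  finally show ?thesis .
qed

lemma val_mult_add_sparse_entries:
  assumes "A \<in> carrier_mat d d" "d * j + l < dim_vec out" "l < d"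
  shows "val (mult_add_tm (sparse_entries A) inp src (d * J) out) $ (d * j + l)
    = out $ (d * j + l) + (if j = J then (\<Sum>c<d. A $$ (l, c) * inp $ (src + c)) else 0)"
proof -
  \<comment> \<open>Uniqueness of quotient and remainder by \<open>d\<close>: different blocks share
    no cell.\<close>
  have iff: "d * J + i = d * j + l \<longleftrightarrow> j = J \<and> i = l" if "i < d" for i
  proof
    assume eq: "d * J + i = d * j + l"
    have "J = (d * J + i) div d" using that by simp
    also have "\<dots> = j" unfolding eq using assms(3) by simp
    finally show "j = J \<and> i = l" using eq by simp
  qed auto
  have "(\<Sum>(i, c, a)\<leftarrow>sparse_entries A. if d * J + i = d * j + l then a * inp $ (src + c) else 0)
    = (\<Sum>c<d. \<Sum>i<d. if i = l then (if j = J then A $$ (i, c) * inp $ (src + c) else 0) else 0)"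
    unfolding sum_list_sparse_entries[OF assms(1)]
    by (intro sum.cong refl) (auto simp: iff)
  also have "\<dots> = (if j = J then (\<Sum>c<d. A $$ (l, c) * inp $ (src + c)) else 0)"
    using assms(3) by (simp add: sum.delta)
  finally show ?thesis
    by (simp add: val_mult_add_tm[OF assms(2)])
qed

section \<open>Correctness and cost of one level of the program\<close>

text \<open>The inner loop of \<open>all_sketch_tm\<close>, with its iteration count
  \<open>J\<close> as a parameter to allow induction on it.\<close>

definition merge_tm ::
    "nat \<Rightarrow> (nat \<times> nat \<times> real) list \<Rightarrow> (nat \<times> nat \<times> real) list \<Rightarrow> real vec \<Rightarrow> nat \<Rightarrow>
     nat \<Rightarrow> real vec \<Rightarrow> real vec tm" where
  "merge_tm d E\<^sub>0 E\<^sub>1 cur h J buf =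
     loop_tm [0..<J] (\<lambda>j buf. do {
       p \<leftarrow> mul_tm d j;
       j' \<leftarrow> add_tm j h;
       p' \<leftarrow> mul_tm d j';
       buf \<leftarrow> mult_add_tm E\<^sub>0 cur p p buf;
       mult_add_tm E\<^sub>1 cur p' p buf
     }) buf"

lemma merge_tm_Suc:
  "merge_tm d E\<^sub>0 E\<^sub>1 cur h (Suc J) buf = bind_tm (merge_tm d E\<^sub>0 E\<^sub>1 cur h J buf) (\<lambda>buf.
     bind_tm (TM () 1) (\<lambda>_. bind_tm (mul_tm d J) (\<lambda>p. bind_tm (add_tm J h) (\<lambda>j'.
       bind_tm (mul_tm d j') (\<lambda>p'. bind_tm (mult_add_tm E\<^sub>0 cur p p buf)
         (mult_add_tm E\<^sub>1 cur p' p))))))"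
  unfolding merge_tm_def
  by (simp add: loop_tm_append) (simp add: bind_tm_def return_tm_def)

lemma time_merge_tm:
  "time (merge_tm d E\<^sub>0 E\<^sub>1 cur h J buf) = J * (4 + 8 * (length E\<^sub>0 + length E\<^sub>1))"
proof (induction J)
  case 0
  then show ?case by (simp add: merge_tm_def)
next
  case (Suc J)
  then show ?case
    by (simp add: merge_tm_Suc time_mult_add_tm mul_tm_def add_tm_def)
qed

lemma dim_merge_tm: "dim_vec (val (merge_tm d E\<^sub>0 E\<^sub>1 cur h J buf)) = dim_vec buf"
proof (induction J)
  case 0
  then show ?case by (simp add: merge_tm_def)
next
  case (Suc J)
  then show ?case
    by (simp add: merge_tm_Suc dim_mult_add_tm)
qed

text \<open>Iteration \<open>j\<close> writes to block \<open>j\<close> only and reads its inputs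
  from \<open>cur\<close>, so a block is final once \<open>j < J\<close>. Blocks are counted from 0
  here.\<close>

lemma val_merge_tm:
  assumes A: "A \<in> carrier_mat d d" and B: "B \<in> carrier_mat d d"
    and p: "d * j + l < dim_vec buf" "l < d"
  shows "val (merge_tm d (sparse_entries A) (sparse_entries B) cur h J buf) $ (d * j + l)
    = buf $ (d * j + l) + (if j < J then (\<Sum>c<d. A $$ (l, c) * cur $ (d * j + c))
        + (\<Sum>c<d. B $$ (l, c) * cur $ (d * (j + h) + c)) else 0)"
proof (induction J)
  case 0
  then show ?case by (simp add: merge_tm_def)
next
  case (Suc J)
  show ?case
    using p
    by (simp add: merge_tm_Suc mul_tm_def add_tm_def val_mult_add_sparse_entries[OF B]
        val_mult_add_sparse_entries[OF A] dim_merge_tm dim_mult_add_tm Suc.IH less_Suc_eq)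
qed

lemma app_map_index:
  assumes "A \<in> carrier_mat d d" "B \<in> carrier_mat d d" "x \<in> carrier_vec d" "y \<in> carrier_vec d"
    and "l < d"
  shows "app_map (A, B) x y $ l = (\<Sum>c<d. A $$ (l, c) * x $ c) + (\<Sum>c<d. B $$ (l, c) * y $ c)"
  using assms by (simp add: app_map_def scalar_prod_def atLeast0LessThan)

lemma block_merge_tm:
  assumes A: "A \<in> carrier_mat d d" and B: "B \<in> carrier_mat d d" and j: "1 \<le> j" "j \<le> J"
  shows "block d (val (merge_tm d (sparse_entries A) (sparse_entries B) cur h J (0\<^sub>v (J * d)))) j
    = app_map (A, B) (block d cur j) (block d cur (j + h))"
proof (rule eq_vecI)
  have car: "app_map (A, B) (block d cur j) (block d cur (j + h)) \<in> carrier_vec d"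
    using A B by (intro app_map_carrier) auto
  then show "dim_vec (block d (val (merge_tm d (sparse_entries A) (sparse_entries B) cur h J
      (0\<^sub>v (J * d)))) j) = dim_vec (app_map (A, B) (block d cur j) (block d cur (j + h)))"
    by (simp add: block_def)
  fix l assume "l < dim_vec (app_map (A, B) (block d cur j) (block d cur (j + h)))"
  then have l: "l < d" using car by simp
  have "d * (j - 1) + l < d * (j - 1) + d" using l by simp
  also have "\<dots> = d * j" using j by (cases j) auto
  also have "\<dots> \<le> J * d" using j by simp
  finally have lt: "d * (j - 1) + l < J * d" .
  \<comment> \<open>\<open>block\<close> counts from 1 and the array from 0; the truncated
    subtraction is harmless as \<open>1 \<le> j\<close>.\<close>
  have shift: "j + h - 1 = j - 1 + h" using j by simp
  have "val (merge_tm d (sparse_entries A) (sparse_entries B) cur h J (0\<^sub>v (J * d)))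
      $ (d * (j - 1) + l)
    = (\<Sum>c<d. A $$ (l, c) * cur $ (d * (j - 1) + c))
      + (\<Sum>c<d. B $$ (l, c) * cur $ (d * (j - 1 + h) + c))"
    using lt l j by (subst val_merge_tm[OF A B]) auto
  also have "\<dots> = app_map (A, B) (block d cur j) (block d cur (j + h)) $ l"
    using l by (subst app_map_index[OF A B]) (auto simp: block_def shift[simplified])
  finally show "block d (val (merge_tm d (sparse_entries A) (sparse_entries B) cur h J
      (0\<^sub>v (J * d)))) j $ l = app_map (A, B) (block d cur j) (block d cur (j + h)) $ l"
    using l by (simp add: block_def)
qed

definition level_tm ::
    "nat \<Rightarrow> (nat \<times> nat \<times> real) list \<times> (nat \<times> nat \<times> real) list \<Rightarrow>
     real vec \<times> nat \<times> nat \<Rightarrow> (real vec \<times> nat \<times> nat) tm" where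
  "level_tm d = (\<lambda>(E\<^sub>0, E\<^sub>1) (cur, cnt, h). do {
     cnt' \<leftarrow> sub_tm cnt h;
     len \<leftarrow> mul_tm cnt' d;
     buf \<leftarrow> new_tm len;
     buf \<leftarrow> merge_tm d E\<^sub>0 E\<^sub>1 cur h cnt' buf;
     h' \<leftarrow> mul_tm 2 h;
     return_tm (buf, cnt', h')
   })"

lemma all_sketch_tm_eq: "all_sketch_tm N d Es x = loop_tm Es (level_tm d) (x, N, 1)"
  unfolding all_sketch_tm_def level_tm_def merge_tm_def ..

text \<open>Removing the shift \<open>2 ^ i\<close> from the count \<open>N + 1 - 2 ^ i\<close>
  gives the count of the next level. \<open>B\<close> bounds the cost of any level: 4 for the loop
  step, one subtraction and two multiplications, \<open>N * d\<close> for the allocation, and the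
  rest for at most \<open>N\<close> merges.\<close>

lemma all_sketch_tm_invariant:
  fixes N d k r :: nat
  defines "B \<equiv> 4 + N * d + N * (4 + 16 * (d * r))"
  assumes maps: "\<And>l. l \<in> {1..k} \<Longrightarrow> \<phi> l \<in> sjl_matrices d r \<times> sjl_matrices d r"
    and x: "x \<in> carrier_vec (N * d)" and k: "2 ^ k \<le> N" and "i \<le> k"
  shows "\<exists>cur \<tau>. all_sketch_tm N d
        (map (\<lambda>i. map_prod sparse_entries sparse_entries (\<phi> i)) [1..<i + 1]) x
      = TM (cur, N + 1 - 2 ^ i, 2 ^ i) \<tau> \<and> \<tau> \<le> i * B \<and> dim_vec cur = (N + 1 - 2 ^ i) * d \<and>
      (\<forall>j\<in>{1..N + 1 - 2 ^ i}. block d cur j = all_sketch_level d \<phi> x i j)"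
  using \<open>i \<le> k\<close>
proof (induction i)
  case 0
  then show ?case using x by (simp add: all_sketch_tm_eq return_tm_def)
next
  case (Suc i)
  let ?Es = "\<lambda>i. map (\<lambda>i. map_prod sparse_entries sparse_entries (\<phi> i)) [1..<i + 1]"
  obtain cur \<tau> where IH: "all_sketch_tm N d (?Es i) x = TM (cur, N + 1 - 2 ^ i, 2 ^ i) \<tau>"
    "\<tau> \<le> i * B" "dim_vec cur = (N + 1 - 2 ^ i) * d"
    "\<And>j. j \<in> {1..N + 1 - 2 ^ i} \<Longrightarrow> block d cur j = all_sketch_level d \<phi> x i j"
    using Suc.IH Suc.prems by auto
  obtain A C where AC: "\<phi> (Suc i) = (A, C)" "A \<in> sjl_matrices d r" "C \<in> sjl_matrices d r"
    using maps[of "Suc i"] Suc.prems by auto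
  have car: "A \<in> carrier_mat d d" "C \<in> carrier_mat d d"
    using AC sjl_matrices_carrier by auto
  define J where "J = N + 1 - 2 ^ Suc i"
  have cnt: "Suc N - (2 ^ i + 2 ^ i) = J" by (simp add: J_def mult_2)
  have "(2::nat) ^ Suc i \<le> 2 ^ k" using Suc.prems by (intro power_increasing) auto
  then have "2 ^ Suc i \<le> N" using k by linarith
  moreover have "(1::nat) \<le> 2 ^ Suc i" by simp
  ultimately have JN: "J \<le> N" and pow: "2 ^ Suc i \<le> N" unfolding J_def by linarith+
  define buf where "buf = val (merge_tm d (sparse_entries A) (sparse_entries C) cur (2 ^ i) J
    (0\<^sub>v (J * d)))"
  have "?Es (Suc i) = ?Es i @ [(sparse_entries A, sparse_entries C)]"
    by (simp add: AC)
  then have "all_sketch_tm N d (?Es (Suc i)) x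
      = bind_tm (all_sketch_tm N d (?Es i) x)
          (loop_tm [(sparse_entries A, sparse_entries C)] (level_tm d))"
    unfolding all_sketch_tm_eq by (simp only: loop_tm_append)
  also have "\<dots> = TM (buf, J, 2 ^ Suc i) (\<tau> + (4 + J * d + J * (4 + 16 * (d * r))))"
    unfolding IH(1)
    by (simp add: level_tm_def cnt buf_def bind_tm_def return_tm_def sub_tm_def mul_tm_def
        new_tm_def time_merge_tm length_sparse_entries[OF AC(2)] length_sparse_entries[OF AC(3)])
  finally have eq: "all_sketch_tm N d (?Es (Suc i)) x
    = TM (buf, J, 2 ^ Suc i) (\<tau> + (4 + J * d + J * (4 + 16 * (d * r))))" .
  have "4 + J * d + J * (4 + 16 * (d * r)) \<le> B"
    unfolding B_def using JN by (intro add_mono mult_le_mono) auto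
  then have "\<tau> + (4 + J * d + J * (4 + 16 * (d * r))) \<le> Suc i * B"
    using IH(2) by simp
  moreover have "dim_vec buf = J * d"
    by (simp add: buf_def dim_merge_tm)
  moreover have "block d buf j = all_sketch_level d \<phi> x (Suc i) j" if j: "j \<in> {1..J}" for j
  proof -
    have "block d buf j = app_map (A, C) (block d cur j) (block d cur (j + 2 ^ i))"
      unfolding buf_def using j car by (intro block_merge_tm) auto
    moreover have "j \<in> {1..N + 1 - 2 ^ i}" "j + 2 ^ i \<in> {1..N + 1 - 2 ^ i}"
      using j pow by (auto simp: J_def)
    ultimately show ?thesis using IH(4) by (simp add: AC)
  qed
  ultimately show ?case
    unfolding eq J_def[symmetric] by blast
qed

lemma all_sketch_prog_correct:
  fixes n m d r k :: nat
  assumes maps: "\<And>l. l \<in> {1..k} \<Longrightarrow> \<phi> l \<in> sjl_matrices d r \<times> sjl_matrices d r"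
    and "x \<in> carrier_vec n" "0 < d" "0 < r" "m \<le> n" "d dvd m" "d dvd n" "m div d = 2 ^ k"
    and t: "t = (n - m) div d + 1"
  shows "dim_vec (val (all_sketch_prog n k d \<phi> x)) = t * d"
    and "\<And>j. j \<in> {1..t} \<Longrightarrow>
      block d (val (all_sketch_prog n k d \<phi> x)) j = all_sketch k d \<phi> x j"
    and "time (all_sketch_prog n k d \<phi> x) \<le> k * (25 * (n * r))"
proof -
  define N where "N = n div d"
  have n: "n = N * d" using assms by (simp add: N_def)
  have m: "m = 2 ^ k * d" using assms by (metis dvd_div_mult_self)
  have k: "2 ^ k \<le> N" using assms(3,5) n m by simp
  have "(n - m) div d = N - 2 ^ k"
    using assms(3) by (simp add: n m flip: diff_mult_distrib)
  then have t: "t = N + 1 - 2 ^ k" using t k by simp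
  obtain cur \<tau> where eq: "all_sketch_tm N d
        (map (\<lambda>i. map_prod sparse_entries sparse_entries (\<phi> i)) [1..<k + 1]) x
      = TM (cur, t, 2 ^ k) \<tau>" and \<tau>: "\<tau> \<le> k * (4 + N * d + N * (4 + 16 * (d * r)))"
    and cur: "dim_vec cur = t * d" "\<And>j. j \<in> {1..t} \<Longrightarrow> block d cur j = all_sketch_level d \<phi> x k j"
    using all_sketch_tm_invariant[where \<phi> = \<phi>, OF maps assms(2)[unfolded n] k le_refl]
    unfolding t by blast
  have prog: "all_sketch_prog n k d \<phi> x = TM cur \<tau>"
    unfolding all_sketch_prog_def N_def[symmetric] eq by (simp add: bind_tm_def return_tm_def)
  show "dim_vec (val (all_sketch_prog n k d \<phi> x)) = t * d"
    using cur by (simp add: prog)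
  show "block d (val (all_sketch_prog n k d \<phi> x)) j = all_sketch k d \<phi> x j" if "j \<in> {1..t}" for j
    using cur(2)[OF that] by (simp add: prog all_sketch_def)
  have "1 \<le> N" using k by (metis one_le_numeral one_le_power order_trans)
  then have "N \<le> n" "1 \<le> n" using assms(3) by (auto simp: n)
  moreover have "n \<le> n * r" using assms(4) by simp
  moreover have "4 + N * d + N * (4 + 16 * (d * r)) = 4 + n + 4 * N + 16 * (n * r)"
    by (simp add: n algebra_simps)
  \<comment> \<open>The constant is 4 + 1 + 4 + 16, each summand being at most its multiple of
    \<open>n * r\<close>.\<close>
  ultimately have "4 + N * d + N * (4 + 16 * (d * r)) \<le> 25 * (n * r)"
    by linarith
  then show "time (all_sketch_prog n k d \<phi> x) \<le> k * (25 * (n * r))"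
    using \<tau> by (simp add: prog) (meson mult_le_mono2 order_trans)
qed

section \<open>Union bound\<close>

text \<open>Write \<open>e\<close> for \<open>real k * \<epsilon>\<close>. Bernoulli gives
  \<open>(1 - \<epsilon>) ^ k \<ge> 1 - e \<ge> (1 - e)\<^sup>2\<close>, and \<open>(1 + \<epsilon>)
  ^ k \<le> exp e \<le> 1 + e + e\<^sup>2 \<le> (1 + e)\<^sup>2\<close>. Taking roots removes the
  squares, so the distortion constant is 1.\<close>

lemma sqrt_bounds_of_power_bounds:
  fixes \<epsilon> S V :: real
  assumes "0 \<le> \<epsilon>" "\<epsilon> \<le> 1" "real k * \<epsilon> \<le> 1" "0 \<le> S"
    and V: "(1 - \<epsilon>) ^ k * S \<le> V" "V \<le> (1 + \<epsilon>) ^ k * S"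
  shows "(1 - real k * \<epsilon>) * sqrt S \<le> sqrt V" "sqrt V \<le> (1 + real k * \<epsilon>) * sqrt S"
proof -
  let ?e = "real k * \<epsilon>"
  have e0: "0 \<le> ?e" using assms by simp
  have "(1 - ?e)\<^sup>2 \<le> 1 - ?e"
    using e0 assms(3) by (simp add: power2_eq_square mult_left_le)
  also have "\<dots> \<le> (1 - \<epsilon>) ^ k"
    using Bernoulli_inequality[of "- \<epsilon>" k] assms by simp
  finally have "(1 - ?e)\<^sup>2 * S \<le> V"
    using V(1) mult_right_mono[of "(1 - ?e)\<^sup>2" "(1 - \<epsilon>) ^ k" S] assms(4) by linarith
  then have "sqrt ((1 - ?e)\<^sup>2 * S) \<le> sqrt V" by simp
  then show "(1 - ?e) * sqrt S \<le> sqrt V"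
    using assms(3) by (simp add: real_sqrt_mult)
  have "(1 + \<epsilon>) ^ k \<le> exp \<epsilon> ^ k"
    using assms by (intro power_mono) auto
  also have "\<dots> = exp ?e" by (simp add: exp_of_nat_mult)
  also have "\<dots> \<le> 1 + ?e + ?e\<^sup>2"
    using e0 assms(3) by (intro exp_bound) auto
  also have "\<dots> \<le> (1 + ?e)\<^sup>2"
    using e0 by (simp add: power2_sum mult.commute)
  finally have "V \<le> (1 + ?e)\<^sup>2 * S"
    using V(2) mult_right_mono[of "(1 + \<epsilon>) ^ k" "(1 + ?e)\<^sup>2" S] assms(4) by linarith
  then have "sqrt V \<le> sqrt ((1 + ?e)\<^sup>2 * S)" by simp
  then show "sqrt V \<le> (1 + ?e) * sqrt S"
    using e0 by (simp add: real_sqrt_mult)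
qed

lemma all_sketch_norm_bounds:
  assumes "0 \<le> \<epsilon>" "\<epsilon> \<le> 1" "real k * \<epsilon> \<le> 1" "2 ^ k \<le> N" "m = d * 2 ^ k"
    and good: "\<And>i j. i < k \<Longrightarrow> 1 \<le> j \<Longrightarrow> j + 2 ^ Suc i \<le> N + 1 \<Longrightarrow> \<not> distorted \<epsilon> d x i j \<phi>"
    and j: "1 \<le> j" "j + 2 ^ k \<le> N + 1"
  shows "(1 - real k * \<epsilon>) * vnorm (window m d x j) \<le> vnorm (all_sketch k d \<phi> x j)"
    and "vnorm (all_sketch k d \<phi> x j) \<le> (1 + real k * \<epsilon>) * vnorm (window m d x j)"
proof -
  have S: "window m d x j \<bullet> window m d x j = (\<Sum>l=j..<j + 2 ^ k. block d x l \<bullet> block d x l)"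
    using assms j by (intro window_scalar_prod_self) auto
  have S0: "0 \<le> window m d x j \<bullet> window m d x j"
    by (subst scalar_prod_self[of _ m]) (auto simp: window_def intro!: sum_nonneg)
  note bounds = all_sketch_level_norm_bounds[OF assms(1,2) le_refl assms(4) good j, folded S]
  show "(1 - real k * \<epsilon>) * vnorm (window m d x j) \<le> vnorm (all_sketch k d \<phi> x j)"
    and "vnorm (all_sketch k d \<phi> x j) \<le> (1 + real k * \<epsilon>) * vnorm (window m d x j)"
    unfolding vnorm_def all_sketch_def
    using sqrt_bounds_of_power_bounds[OF assms(1-3) S0] bounds by blast+
qed

lemma prob_all_sketch_norm_bounds:
  fixes n m d r k t :: nat
  assumes "0 < \<epsilon>" "0 < d" "0 < r" "r \<le> d" "m \<le> n" "d dvd m" "d dvd n" "m div d = 2 ^ k"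
    and t: "t = (n - m) div d + 1" and "real k * \<epsilon> \<le> 1" "2 \<le> n" "0 \<le> c"
    and "32 * ((c + 3) * ln n) \<le> real d * \<epsilon>\<^sup>2" "8 * ((c + 3) * ln n) \<le> real r * \<epsilon>"
  shows "measure_pmf.prob (sketch_maps k d r) {\<phi>. \<forall>j\<in>{1..t}.
      (1 - real k * \<epsilon>) * vnorm (window m d x j) \<le> vnorm (all_sketch k d \<phi> x j) \<and>
      vnorm (all_sketch k d \<phi> x j) \<le> (1 + real k * \<epsilon>) * vnorm (window m d x j)}
    \<ge> 1 - real n powr (- c)" (is "measure_pmf.prob ?P ?E \<ge> _")
proof -
  define N where "N = n div d"
  have n: "n = N * d" using assms by (simp add: N_def)
  have m: "m = d * 2 ^ k" using assms by (metis dvd_mult_div_cancel)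
  have k: "2 ^ k \<le> N" using assms(2,5) n m by (simp add: mult.commute)
  have "(n - m) div d = N - 2 ^ k"
    using assms(2) by (simp add: n m mult.commute[of d] flip: diff_mult_distrib)
  then have "t + 2 ^ k = N + 1" using t k by simp
  then have jt: "j + 2 ^ k \<le> N + 1" if "j \<in> {1..t}" for j
    using that by simp
  show ?thesis
  proof (cases "k = 0")
    \<comment> \<open>No map is applied, so the bounds hold with distortion 0. The case is separate
      because \<open>real k * \<epsilon> \<le> 1\<close> puts no bound on \<epsilon> here.\<close>
    case True
    have "?E = UNIV"
      using all_sketch_norm_bounds[of 0 k N m d x] k m jt True by auto
    then show ?thesis by simp
  next
    case False
    then have "1 * \<epsilon> \<le> real k * \<epsilon>" using assms(1) by (intro mult_right_mono) auto
    then have e1: "\<epsilon> \<le> 1" using assms(10) by simp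
    define L where "L = (c + 3) * ln (real n)"
    define bad where "bad = (\<Union>(i, j)\<in>{..<k} \<times> {1..N}. {\<phi>. distorted \<epsilon> d x i j \<phi>})"
    have L0: "0 \<le> L" using assms by (simp add: L_def)
    have "- bad \<subseteq> ?E"
    proof
      fix \<phi> assume "\<phi> \<in> - bad"
      then have nb: "\<not> distorted \<epsilon> d x i j \<phi>" if "i < k" "1 \<le> j" "j \<le> N" for i j
        using that by (auto simp: bad_def)
      have good: "\<not> distorted \<epsilon> d x i j \<phi>" if "i < k" "1 \<le> j" "j + 2 ^ Suc i \<le> N + 1" for i j
      proof -
        have "(1::nat) \<le> 2 ^ Suc i" by simp
        then have "j \<le> N" using that(3) by linarith
        then show ?thesis using nb that by blast
      qed
      show "\<phi> \<in> ?E"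
        using all_sketch_norm_bounds[OF _ e1 assms(10) k m good] assms(1) jt by auto
    qed
    then have "measure_pmf.prob ?P (- bad) \<le> measure_pmf.prob ?P ?E"
      by (intro measure_pmf.finite_measure_mono) auto
    moreover have "measure_pmf.prob ?P (- bad) = 1 - measure_pmf.prob ?P bad"
      using measure_pmf.prob_compl[of bad ?P] by (simp add: Compl_eq_Diff_UNIV)
    moreover have "measure_pmf.prob ?P bad \<le> real n powr (- c)"
    proof -
      have "measure_pmf.prob ?P bad \<le> (\<Sum>(i, j)\<in>{..<k} \<times> {1..N}.
          measure_pmf.prob ?P {\<phi>. distorted \<epsilon> d x i j \<phi>})"
        unfolding bad_def case_prod_unfold by (intro measure_UNION_le) auto
      also have "\<dots> \<le> (\<Sum>(i, j)\<in>{..<k} \<times> {1..N}. 2 * exp (- L))"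
      proof (rule sum_mono)
        fix p assume "p \<in> {..<k} \<times> {1..N}"
        then show "(case p of (i, j) \<Rightarrow> measure_pmf.prob ?P {\<phi>. distorted \<epsilon> d x i j \<phi>})
            \<le> (case p of (i, j) \<Rightarrow> 2 * exp (- L))"
          using prob_distorted[OF assms(3,4,1) L0 assms(13,14)[folded L_def]] by auto
      qed
      also have "\<dots> = 2 * real k * real N * exp (- L)"
        by (simp add: case_prod_unfold)
      \<comment> \<open>Both \<open>k\<close> and \<open>N\<close> are at most \<open>n\<close>, and
        \<open>2 \<le> n\<close> absorbs the factor 2. The resulting cube accounts for the 3 in
        \<open>c + 3\<close>.\<close>
      also have "\<dots> \<le> real n * real n * real n * exp (- L)"
      proof (intro mult_mono)
        show Nn: "real N \<le> real n" unfolding N_def by (intro of_nat_mono div_le_dividend)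
        have "k < 2 ^ k" by (rule less_exp)
        then show "real k \<le> real n" using k Nn by linarith
      qed (use assms(11) in simp_all)
      also have "exp (- L) = real n powr (- (c + 3))"
        using assms(11) by (simp add: L_def powr_def algebra_simps)
      also have "real n * real n * real n = real n powr 3"
        using assms by (simp add: powr_numeral power3_eq_cube)
      also have "real n powr 3 * real n powr (- (c + 3)) = real n powr (- c)"
        unfolding powr_add[symmetric] by simp
      finally show ?thesis .
    qed
    ultimately show ?thesis by linarith
  qed
qed

section \<open>Choice of the constants\<close>

lemma all_sketch_guarantee:
  fixes n m d r k t :: nat and \<epsilon> c \<alpha> \<beta> C\<^sub>0 C\<^sub>1 :: real and x :: "real vec"
  assumes c: "c > 0" and \<alpha>: "\<alpha> > 0" and \<beta>: "\<beta> \<ge> \<alpha>"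
    and C\<^sub>0: "C\<^sub>0 > 0" "32 * (c + 3) \<le> C\<^sub>0" "8 * (c + 3) \<le> \<alpha> * C\<^sub>0" and C\<^sub>1: "C\<^sub>1 \<ge> C\<^sub>0"
    and \<epsilon>: "0 < \<epsilon>" and d: "0 < d"
    and dl: "C\<^sub>0 * ln (real n) / \<epsilon>\<^sup>2 \<le> real d" and du: "real d \<le> C\<^sub>1 * ln (real n) / \<epsilon>\<^sup>2"
    and rl: "\<alpha> * (real d * \<epsilon>) \<le> real r" and ru: "real r \<le> \<beta> * (real d * \<epsilon>)" and rd: "r \<le> d"
    and mn: "m \<le> n" "d dvd m" "d dvd n" "m div d = 2 ^ k" and t: "t = (n - m) div d + 1"
    and k\<epsilon>: "real k * \<epsilon> \<le> 1" and x: "x \<in> carrier_vec n"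
  shows "measure_pmf.prob (sketch_maps k d r)
      {\<phi>. \<forall>j\<in>{1..t}.
         (1 - real k * \<epsilon>) * vnorm (window m d x j) \<le> vnorm (all_sketch k d \<phi> x j) \<and>
         vnorm (all_sketch k d \<phi> x j) \<le> (1 + real k * \<epsilon>) * vnorm (window m d x j)}
      \<ge> 1 - real n powr (- c)"
    and "\<And>\<phi>. \<phi> \<in> set_pmf (sketch_maps k d r) \<Longrightarrow>
      dim_vec (val (all_sketch_prog n k d \<phi> x)) = t * d \<and>
      (\<forall>j\<in>{1..t}. block d (val (all_sketch_prog n k d \<phi> x)) j = all_sketch k d \<phi> x j) \<and>
      real (time (all_sketch_prog n k d \<phi> x))
        \<le> 50 * \<beta> * C\<^sub>1 * (real n * (ln (real n))\<^sup>2 / \<epsilon>) \<and>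
      (\<forall>j\<in>{1..t}. all_sketch k d \<phi> x j = single_sketch k d \<phi> (window m d x j)) \<and>
      vec_linear m d (single_sketch k d \<phi>)"
proof -
  \<comment> \<open>A positive \<open>d\<close> below this quantity forces \<open>ln n > 0\<close>,
    hence \<open>n \<ge> 2\<close>.\<close>
  have "0 < C\<^sub>1 * ln (real n) / \<epsilon>\<^sup>2" using d du by linarith
  then have ln: "ln (real n) > 0"
    using \<epsilon> C\<^sub>0 C\<^sub>1 by (simp add: zero_less_divide_iff zero_less_mult_iff)
  have m: "m = 2 ^ k * d" using mn by (metis dvd_div_mult_self)
  then have "m > 0" using d by simp
  then have n2: "2 \<le> n" using ln mn by (cases "n = 1") auto
  have "0 < \<alpha> * (real d * \<epsilon>)" using \<alpha> d \<epsilon> by simp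
  then have r: "0 < r" using rl by linarith
  have de: "C\<^sub>0 * ln (real n) \<le> real d * \<epsilon>\<^sup>2"
    using dl \<epsilon> by (simp add: pos_divide_le_eq)
  have h1: "32 * ((c + 3) * ln (real n)) \<le> real d * \<epsilon>\<^sup>2"
    using mult_right_mono[OF C\<^sub>0(2), of "ln (real n)"] ln de by (simp only: mult.assoc) linarith
  \<comment> \<open>The sparsity is only known to be at least
    \<open>\<alpha> * (real d * \<epsilon>)\<close>, so \<open>C\<^sub>0\<close> must compensate for
    \<alpha>.\<close>
  have h2: "8 * ((c + 3) * ln (real n)) \<le> real r * \<epsilon>"
  proof -
    have "8 * (c + 3) * ln (real n) \<le> \<alpha> * C\<^sub>0 * ln (real n)"
      using mult_right_mono[OF C\<^sub>0(3)] ln by simp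
    also have "\<dots> \<le> \<alpha> * (real d * \<epsilon>\<^sup>2)"
      using de \<alpha> by simp
    also have "\<dots> \<le> real r * \<epsilon>"
      using mult_right_mono[OF rl, of \<epsilon>] \<epsilon> by (simp add: power2_eq_square mult_ac)
    finally show ?thesis by (simp only: mult.assoc)
  qed
  show "measure_pmf.prob (sketch_maps k d r)
      {\<phi>. \<forall>j\<in>{1..t}.
         (1 - real k * \<epsilon>) * vnorm (window m d x j) \<le> vnorm (all_sketch k d \<phi> x j) \<and>
         vnorm (all_sketch k d \<phi> x j) \<le> (1 + real k * \<epsilon>) * vnorm (window m d x j)}
      \<ge> 1 - real n powr (- c)"
    using c by (intro prob_all_sketch_norm_bounds \<epsilon> d r rd mn t k\<epsilon> n2 h1 h2) simp
  show "dim_vec (val (all_sketch_prog n k d \<phi> x)) = t * d \<and>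
       (\<forall>j\<in>{1..t}. block d (val (all_sketch_prog n k d \<phi> x)) j = all_sketch k d \<phi> x j) \<and>
       real (time (all_sketch_prog n k d \<phi> x))
         \<le> 50 * \<beta> * C\<^sub>1 * (real n * (ln (real n))\<^sup>2 / \<epsilon>) \<and>
       (\<forall>j\<in>{1..t}. all_sketch k d \<phi> x j = single_sketch k d \<phi> (window m d x j)) \<and>
       vec_linear m d (single_sketch k d \<phi>)"
    if \<phi>: "\<phi> \<in> set_pmf (sketch_maps k d r)" for \<phi>
  proof (intro conjI ballI)
    note maps = set_sketch_maps[OF r rd \<phi>]
    have car: "\<phi> l \<in> carrier_mat d d \<times> carrier_mat d d" if "l \<in> {1..k}" for l
      using maps[OF that] sjl_matrices_carrier[of d r] by auto
    note prog = all_sketch_prog_correct[where \<phi> = \<phi>, OF maps x d r mn t]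
    show "dim_vec (val (all_sketch_prog n k d \<phi> x)) = t * d"
      by (rule prog(1))
    show "block d (val (all_sketch_prog n k d \<phi> x)) j = all_sketch k d \<phi> x j"
      if "j \<in> {1..t}" for j
      by (rule prog(2)[OF _ that])
    show "all_sketch k d \<phi> x j = single_sketch k d \<phi> (window m d x j)"
      if "j \<in> {1..t}" for j
      using all_sketch_level_eq_single_sketch_level[of j 1 k "2 ^ k" m d \<phi> x] that
      by (simp add: all_sketch_def single_sketch_def m mult.commute)
    show "vec_linear m d (single_sketch k d \<phi>)"
      using vec_linear_single_sketch_level[of k \<phi> d 1 m] car
      by (simp add: single_sketch_def[abs_def] m mult.commute)
    \<comment> \<open>One logarithm of the running time is the number of levels:
      \<open>2 ^ k \<le> n\<close> and \<open>ln 2 \<ge> 1 / 2\<close>.\<close>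
    have kn: "real k \<le> 2 * ln (real n)"
    proof -
      have "2 ^ k \<le> m" using m d by simp
      then have "2 ^ k \<le> n" using mn(1) by simp
      then have "real (2 ^ k) \<le> real n" by (rule of_nat_mono)
      then have "ln (2 ^ k) \<le> ln (real n)" by (subst ln_le_cancel_iff) (use n2 in auto)
      then have "real k * ln 2 \<le> ln (real n)" by (simp add: ln_realpow)
      moreover have "real k * (1 / 2) \<le> real k * ln 2"
        using ln2_ge_two_thirds by (intro mult_left_mono) auto
      ultimately show ?thesis by simp
    qed
    \<comment> \<open>The other logarithm and the division by \<epsilon> come from the sparsity,
      through the upper bound on \<open>d\<close>.\<close>
    have rn: "real r \<le> \<beta> * C\<^sub>1 * ln (real n) / \<epsilon>"
    proof -
      have "\<beta> * (real d * \<epsilon>) \<le> \<beta> * (C\<^sub>1 * ln (real n) / \<epsilon>\<^sup>2 * \<epsilon>)"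
        using du \<epsilon> \<alpha> \<beta> by (intro mult_left_mono mult_right_mono) auto
      also have "\<dots> = \<beta> * C\<^sub>1 * ln (real n) / \<epsilon>"
        using \<epsilon> by (simp add: power2_eq_square)
      finally show ?thesis using ru by linarith
    qed
    have "real (time (all_sketch_prog n k d \<phi> x)) \<le> real (k * (25 * (n * r)))"
      using prog(3) by (rule of_nat_mono)
    also have "\<dots> = real k * (25 * real n * real r)" by simp
    also have "\<dots> \<le> 2 * ln (real n) * (25 * real n * (\<beta> * C\<^sub>1 * ln (real n) / \<epsilon>))"
      using kn rn ln by (intro mult_mono) auto
    also have "\<dots> = 50 * \<beta> * C\<^sub>1 * (real n * (ln (real n))\<^sup>2 / \<epsilon>)"
      by (simp add: power2_eq_square)
    finally show "real (time (all_sketch_prog n k d \<phi> x))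
      \<le> 50 * \<beta> * C\<^sub>1 * (real n * (ln (real n))\<^sup>2 / \<epsilon>)" .
  qed
qed

text \<open>The quantifiers encode the O-terms: \<open>K\<close> is absolute,
  \<open>C\<^sub>0\<close> says how large \<open>d\<close> must be for the failure exponent
  \<open>c\<close>, \<open>C\<^sub>1\<close> bounds \<open>d\<close> from above, \<alpha> and
  \<beta> bracket the sparsity, and \<open>T\<close> may depend on these but not on the
  instance.\<close>

theorem theorem9:
  shows "\<exists>K>0. \<forall>c>0. \<forall>\<alpha>>0. \<forall>\<beta>\<ge>\<alpha>. \<exists>C\<^sub>0>0. \<forall>C\<^sub>1\<ge>C\<^sub>0. \<exists>T>0.
    \<forall>(n::nat) (m::nat) (d::nat) (r::nat) (k::nat) (t::nat) (\<epsilon>::real) (x::real vec).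
      0 < \<epsilon> \<longrightarrow> 0 < d \<longrightarrow>
      C\<^sub>0 * ln (real n) / \<epsilon>\<^sup>2 \<le> real d \<longrightarrow> real d \<le> C\<^sub>1 * ln (real n) / \<epsilon>\<^sup>2 \<longrightarrow>
      \<alpha> * (real d * \<epsilon>) \<le> real r \<longrightarrow> real r \<le> \<beta> * (real d * \<epsilon>) \<longrightarrow> r \<le> d \<longrightarrow>
      m \<le> n \<longrightarrow> d dvd m \<longrightarrow> d dvd n \<longrightarrow> m div d = 2 ^ k \<longrightarrow> t = (n - m) div d + 1 \<longrightarrow>
      real k * \<epsilon> \<le> 1 \<longrightarrow> x \<in> carrier_vec n \<longrightarrow>
        measure_pmf.prob (sketch_maps k d r)
          {\<phi>. \<forall>j\<in>{1..t}.
             (1 - K * (real k * \<epsilon>)) * vnorm (window m d x j) \<le> vnorm (all_sketch k d \<phi> x j) \<and>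
             vnorm (all_sketch k d \<phi> x j) \<le> (1 + K * (real k * \<epsilon>)) * vnorm (window m d x j)}
          \<ge> 1 - real n powr (- c) \<and>
        (\<forall>\<phi>\<in>set_pmf (sketch_maps k d r).
           dim_vec (val (all_sketch_prog n k d \<phi> x)) = t * d \<and>
           (\<forall>j\<in>{1..t}. block d (val (all_sketch_prog n k d \<phi> x)) j = all_sketch k d \<phi> x j) \<and>
           real (time (all_sketch_prog n k d \<phi> x)) \<le> T * (real n * (ln (real n))\<^sup>2 / \<epsilon>) \<and>
           (\<forall>j\<in>{1..t}. all_sketch k d \<phi> x j = single_sketch k d \<phi> (window m d x j)) \<and>
           vec_linear m d (single_sketch k d \<phi>))"
proof (rule exI[of _ 1], intro conjI allI impI)
  let "\<exists>K>0. \<forall>c>0. \<forall>\<alpha>>0. \<forall>\<beta>\<ge>\<alpha>. \<exists>C\<^sub>0>0. \<forall>C\<^sub>1\<ge>C\<^sub>0. \<exists>T>0. ?P K c \<alpha> \<beta> C\<^sub>0 C\<^sub>1 T" = ?thesis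
  fix c \<alpha> \<beta> :: real
  assume c: "c > 0" and \<alpha>: "\<alpha> > 0" and \<beta>: "\<beta> \<ge> \<alpha>"
  \<comment> \<open>The first summand meets the requirement on the dimension, the second the one on
    the sparsity.\<close>
  define C\<^sub>0 where "C\<^sub>0 = 32 * (c + 3) + 8 * (c + 3) / \<alpha>"
  have C\<^sub>0: "C\<^sub>0 > 0" "32 * (c + 3) \<le> C\<^sub>0" "8 * (c + 3) \<le> \<alpha> * C\<^sub>0"
    using c \<alpha> by (auto simp: C\<^sub>0_def field_simps intro!: add_pos_pos)
  show "\<exists>C\<^sub>0>0. \<forall>C\<^sub>1\<ge>C\<^sub>0. \<exists>T>0. ?P 1 c \<alpha> \<beta> C\<^sub>0 C\<^sub>1 T"
  proof (rule exI[of _ C\<^sub>0], rule conjI[OF C\<^sub>0(1)], intro allI impI)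
    fix C\<^sub>1 :: real
    assume C\<^sub>1: "C\<^sub>1 \<ge> C\<^sub>0"
    have T: "50 * \<beta> * C\<^sub>1 > 0" using C\<^sub>0 C\<^sub>1 \<alpha> \<beta> by simp
    show "\<exists>T>0. ?P 1 c \<alpha> \<beta> C\<^sub>0 C\<^sub>1 T"
      unfolding mult_1
      by (rule exI[of _ "50 * \<beta> * C\<^sub>1"], rule conjI[OF T], intro allI impI, rule conjI;
          (rule ballI)?; rule all_sketch_guarantee[OF c \<alpha> \<beta> C\<^sub>0 C\<^sub>1]; assumption)
  qed
qed simp

end
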